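(* Let $1\leq\alpha<2$, let $n>\alpha$ be an integer, and let $u$ be a nonnegative bounded solution of $$(-\Delta)^{\frac{\alpha}{2}}u=x_1u^p\quad\text{in }\mathbb R^n.$$ If $1<p<\infty$, then $u\equiv 0$.
   Context: Here $x=(x_1,\dots,x_n)\in\mathbb R^n$, and the fractional Laplacian on $\mathbb R^n$ is the nonlocal operator $(-\Delta)^{\alpha/2}u(x)=C_{n,\alpha}\,\mathrm{P.V.}\int_{\mathbb R^n}\frac{u(x)-u(y)}{|x-y|^{n+\alpha}}\,dy$, equivalently (for Schwartz functions) $\widehat{(-\Delta)^{\alpha/2}u}(\xi)=|\xi|^{\alpha}\hat u(\xi)$. The equation is understood through the Caffarelli–Silvestre extension: $u=w(\cdot,0)$ where $w$ solves $-\operatorname{div}(y^{1-\alpha}\nabla w)=0$ in $\mathbb R^{n+1}_+=\{(x,y):x\in\mathbb R^n,\,y>0\}$, and $-\lim_{y\to0^+}y^{1-\alpha}\partial_y w(x,y)=k_\alpha(-\Delta)^{\alpha/2}u(x)$ with $k_\alpha=\frac{2^{1-\alpha}\Gamma(1-\alpha/2)}{\Gamma(\alpha/2)}>0$. *)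

theory Defs
  imports "HOL-Analysis.Analysis"
begin

definition gradient :: "('a::euclidean_space \<Rightarrow> real) \<Rightarrow> 'a \<Rightarrow> 'a" where
  "gradient f z = (THE D. GDERIV f z :> D)"

definition divergence :: "('a::euclidean_space \<Rightarrow> 'a) \<Rightarrow> 'a \<Rightarrow> real" where
  "divergence F z = (\<Sum>b\<in>Basis. frechet_derivative F (at z) b \<bullet> b)"

text \<open>The following two notions are meant for open \<open>S\<close> only.\<close>

definition C1_on :: "('a::euclidean_space \<Rightarrow> 'b::real_normed_vector) \<Rightarrow> 'a set \<Rightarrow> bool" where
  "C1_on f S \<longleftrightarrow> (\<forall>z\<in>S. f differentiable (at z)) \<and>
     (\<forall>v. continuous_on S (\<lambda>z. frechet_derivative f (at z) v))"

definition C2_on :: "('a::euclidean_space \<Rightarrow> real) \<Rightarrow> 'a set \<Rightarrow> bool" where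
  "C2_on f S \<longleftrightarrow> C1_on f S \<and> C1_on (gradient f) S"

text \<open>
  A point of the closed upper half-space is a pair of \<open>x\<close> and a height \<open>y \<ge> 0\<close>; values of
  \<open>w\<close> at negative heights play no role.

  Boundedness selects the Caffarelli--Silvestre extension of a bounded function, that is, its
  convolution with the Poisson kernel of the operator. Without such a condition the extension
  is not determined by \<open>u\<close>: since \<open>y powr \<alpha>\<close> solves the differential equation and vanishes at
  \<open>y = 0\<close>, any affine function of \<open>x\<close> times \<open>y powr \<alpha>\<close> could be added to \<open>w\<close>.
\<close>

definition cs_extension ::
    "real \<Rightarrow> (real^'n \<Rightarrow> real) \<Rightarrow> ((real^'n) \<times> real \<Rightarrow> real) \<Rightarrow> bool" where
  "cs_extension \<alpha> u w \<longleftrightarrow>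
     continuous_on {z. snd z \<ge> 0} w \<and>
     bounded (w ` {z. snd z \<ge> 0}) \<and>
     (\<forall>x. w (x, 0) = u x) \<and>
     C2_on w {z. snd z > 0} \<and>
     (\<forall>z. snd z > 0 \<longrightarrow>
        - divergence (\<lambda>\<zeta>. (snd \<zeta> powr (1 - \<alpha>)) *\<^sub>R gradient w \<zeta>) z = 0)"

definition cs_const :: "real \<Rightarrow> real" where
  "cs_const \<alpha> = 2 powr (1 - \<alpha>) * Gamma (1 - \<alpha> / 2) / Gamma (\<alpha> / 2)"

text \<open>
  The function \<open>g\<close> is the fractional Laplacian \<open>(-\<Delta>)\<close> to the power \<open>\<alpha> / 2\<close> of the bounded
  function \<open>u\<close>, as the conormal derivative of the extension of \<open>u\<close>. The limit is only required
  pointwise in \<open>x\<close>.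
\<close>

definition has_frac_laplacian ::
    "real \<Rightarrow> (real^'n \<Rightarrow> real) \<Rightarrow> (real^'n \<Rightarrow> real) \<Rightarrow> bool" where
  "has_frac_laplacian \<alpha> u g \<longleftrightarrow>
     (\<exists>w. cs_extension \<alpha> u w \<and>
        (\<forall>x. ((\<lambda>y. - (y powr (1 - \<alpha>) * deriv (\<lambda>t. w (x, t)) y))
               \<longlongrightarrow> cs_const \<alpha> * g x) (at_right 0)))"

end

theory Submission
  imports Defs
begin

text \<open>
  The whole argument is carried out on the extension \<open>w\<close> and rests on the maximum principle: at an
  interior minimum the operator
  \<open>L = \<Delta> + (1 - \<alpha>) / y * \<partial>\<^sub>y\<close>, which is \<open>y powr (\<alpha> - 1)\<close> times the divergence of
  \<open>y powr (1 - \<alpha>) * \<nabla>\<close>, is nonnegative, and at a minimum on \<open>y = 0\<close> the flux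
  \<open>N = - lim y powr (1 - \<alpha>) * \<partial>\<^sub>y\<close> is nonpositive (\<open>min_principle\<close>). Every estimate is then a matter
  of exhibiting an explicit comparison function.

  On \<open>x\<^sub>k \<ge> 0\<close>, solutions are nondecreasing in \<open>x\<^sub>k\<close>, by moving planes. Let
  \<open>W m\<close> be the difference of \<open>w\<close> reflected in \<open>x\<^sub>k = m\<close> and \<open>w\<close>; the aim is \<open>W m \<ge> 0\<close> on
  \<open>x\<^sub>k \<le> m\<close> for every \<open>m \<ge> 0\<close>. At points of \<open>y = 0\<close> where
  \<open>W m < 0\<close>, a negative minimum is excluded for one of three reasons. Where \<open>x\<^sub>k \<le> 0\<close> the nonlinearity
  has the good sign. Near the plane, and also wherever \<open>u\<close> is small, the flux of \<open>W m\<close> is at least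
  \<open>V * W m\<close> with a coefficient \<open>V\<close> smaller than the ratio of flux to value of an explicit positive
  supersolution: close to the plane this ratio can be made as large as desired, and \<open>V\<close> is of order
  \<open>u powr (p - 1)\<close>, so \<open>p > 1\<close> makes it small with \<open>u\<close>. In the rest of the strip
  \<open>0 < x\<^sub>k < m\<close>, where \<open>u\<close> is not small and \<open>x\<^sub>k\<close> is not close to \<open>m\<close>,
  the strict monotonicity of \<open>x\<^sub>k * t powr p\<close> in \<open>x\<^sub>k\<close> gives a positive flux as soon as \<open>W m\<close> is only
  slightly negative. Hence an almost nonnegative \<open>W m\<close> is nonnegative (\<open>W_nonneg_of_almost\<close>), with a
  tolerance uniform for bounded \<open>m\<close>. Since \<open>u\<close> is uniformly continuous in \<open>x\<^sub>k\<close> on slabs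
  (\<open>W_lower_modulus\<close>), the plane can be advanced from \<open>m = 0\<close> by steps of fixed length
  (\<open>W_nonneg\<close>).

  The domain is unbounded in all directions, so minima could escape to infinity. The quotient of
  \<open>W m\<close> by the supersolution \<open>barrier\<close> prevents this: the barrier tends to infinity and at the same
  time satisfies the strict flux inequality on the strip (\<open>barrier_op\<close>, \<open>barrier_conormal\<close>).

  Finally, if \<open>u\<close> were positive somewhere, monotonicity would keep it above a positive constant on
  balls of fixed radius that run off to \<open>x\<^sub>k = \<infinity>\<close>. The flux \<open>x\<^sub>k * u powr p\<close> becomes arbitrarily large
  there, which forces \<open>w\<close> itself to be large (\<open>no_large_flux\<close>), against boundedness.
\<close>

section \<open>Second-order derivatives along coordinate lines\<close>

text \<open>
  The comparison functions below are products and powers of a few simple expressions. Since the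
  maximum principle only tests pure second derivatives, a calculus of twice differentiable functions
  of one variable is enough to compute the operator on them.
\<close>

definition deriv2 :: "(real \<Rightarrow> real) \<Rightarrow> real \<Rightarrow> real \<Rightarrow> real \<Rightarrow> bool" where
  "deriv2 g a d1 d2 \<longleftrightarrow> (\<exists>g'. (\<forall>\<^sub>F t in nhds a. (g has_real_derivative g' t) (at t)) \<and>
      g' a = d1 \<and> (g' has_real_derivative d2) (at a))"

lemma deriv2I:
  assumes "\<forall>\<^sub>F t in nhds a. (g has_real_derivative g' t) (at t)"
    and "(g' has_real_derivative d2) (at a)"
  shows "deriv2 g a (g' a) d2"
  using assms unfolding deriv2_def by blast

lemma deriv2_add:
  assumes "deriv2 f a f1 f2" "deriv2 g a g1 g2"
  shows "deriv2 (\<lambda>t. f t + g t) a (f1 + g1) (f2 + g2)"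
proof -
  from assms obtain f' g' where
    f: "\<forall>\<^sub>F t in nhds a. (f has_real_derivative f' t) (at t)" "f' a = f1"
      "(f' has_real_derivative f2) (at a)" and
    g: "\<forall>\<^sub>F t in nhds a. (g has_real_derivative g' t) (at t)" "g' a = g1"
      "(g' has_real_derivative g2) (at a)"
    unfolding deriv2_def by blast
  have "\<forall>\<^sub>F t in nhds a. ((\<lambda>t. f t + g t) has_real_derivative f' t + g' t) (at t)"
    using f(1) g(1) by eventually_elim (rule DERIV_add)
  from deriv2I[OF this DERIV_add[OF f(3) g(3)]] show ?thesis
    by (simp add: f(2) g(2))
qed

lemma deriv2_mult:
  assumes "deriv2 f a f1 f2" "deriv2 g a g1 g2"
  shows "deriv2 (\<lambda>t. f t * g t) a (f1 * g a + g1 * f a) (f2 * g a + 2 * f1 * g1 + g2 * f a)"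
proof -
  from assms obtain f' g' where
    f: "\<forall>\<^sub>F t in nhds a. (f has_real_derivative f' t) (at t)" "f' a = f1"
      "(f' has_real_derivative f2) (at a)" and
    g: "\<forall>\<^sub>F t in nhds a. (g has_real_derivative g' t) (at t)" "g' a = g1"
      "(g' has_real_derivative g2) (at a)"
    unfolding deriv2_def by blast
  have 1: "\<forall>\<^sub>F t in nhds a. ((\<lambda>t. f t * g t) has_real_derivative f' t * g t + g' t * f t) (at t)"
    using f(1) g(1) by eventually_elim (rule DERIV_mult)
  have fa: "(f has_real_derivative f1) (at a)" and ga: "(g has_real_derivative g1) (at a)"
    using eventually_nhds_x_imp_x[OF f(1)] eventually_nhds_x_imp_x[OF g(1)] f(2) g(2) by auto
  have "((\<lambda>t. f' t * g t + g' t * f t) has_real_derivative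
      (f2 * g a + g1 * f' a) + (g2 * f a + f1 * g' a)) (at a)"
    by (intro DERIV_add DERIV_mult f g fa ga)
  from deriv2I[OF 1 this] show ?thesis
    by (simp add: f(2) g(2) algebra_simps)
qed

lemma deriv2_compose:
  assumes "deriv2 f a f1 f2" "deriv2 F (f a) F1 F2"
  shows "deriv2 (\<lambda>t. F (f t)) a (F1 * f1) (F2 * f1\<^sup>2 + F1 * f2)"
proof -
  from assms obtain f' F' where
    f: "\<forall>\<^sub>F t in nhds a. (f has_real_derivative f' t) (at t)" "f' a = f1"
      "(f' has_real_derivative f2) (at a)" and
    F: "\<forall>\<^sub>F t in nhds (f a). (F has_real_derivative F' t) (at t)" "F' (f a) = F1"
      "(F' has_real_derivative F2) (at (f a))"
    unfolding deriv2_def by blast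
  have fa: "(f has_real_derivative f1) (at a)"
    using eventually_nhds_x_imp_x[OF f(1)] f(2) by auto
  have "isCont f a" using fa by (rule DERIV_isCont)
  then have "filterlim f (nhds (f a)) (nhds a)"
    unfolding isCont_def using tendsto_at_iff_tendsto_nhds by blast
  then have "\<forall>\<^sub>F t in nhds a. (F has_real_derivative F' (f t)) (at (f t))"
    using F(1) unfolding filterlim_iff by blast
  with f(1) have 1: "\<forall>\<^sub>F t in nhds a. ((\<lambda>t. F (f t)) has_real_derivative F' (f t) * f' t) (at t)"
    by eventually_elim (rule DERIV_chain2)
  have "((\<lambda>t. F' (f t) * f' t) has_real_derivative (F2 * f1) * f' a + f2 * F' (f a)) (at a)"
    by (rule DERIV_mult[OF DERIV_chain2[where f = F' and g = f, OF F(3) fa] f(3)])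
  from deriv2I[OF 1 this] show ?thesis
    by (simp add: f(2) F(2) algebra_simps power2_eq_square)
qed

lemma deriv2_quadratic: "deriv2 (\<lambda>t. A + B * t + C * t\<^sup>2) 0 B (2 * C)"
proof -
  have "deriv2 (\<lambda>t. A + B * t + C * t\<^sup>2) 0 ((\<lambda>t. B + 2 * C * t) 0) (2 * C)"
    by (rule deriv2I) (auto intro!: derivative_eq_intros always_eventually)
  then show ?thesis by simp
qed

lemma deriv2_powr:
  assumes "(0::real) < a"
  shows "deriv2 (\<lambda>t. t powr r) a (r * a powr r / a) (r * (r - 1) * a powr r / a\<^sup>2)"
proof -
  have 1: "\<forall>\<^sub>F t in nhds a. ((\<lambda>t. t powr r) has_real_derivative r * t powr (r - 1)) (at t)"
    using eventually_nhds_in_open[of "{0<..}" a] assms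
    by (auto elim!: eventually_mono intro!: has_real_derivative_powr)
  have 2: "((\<lambda>t. r * t powr (r - 1)) has_real_derivative r * ((r - 1) * a powr (r - 1 - 1))) (at a)"
    by (intro DERIV_cmult has_real_derivative_powr assms)
  have "a powr (r - 1) = a powr r / a" "a powr (r - 1 - 1) = a powr r / a\<^sup>2"
    using assms by (simp_all add: powr_diff power2_eq_square)
  then show ?thesis using deriv2I[OF 1 2] by (simp add: mult.assoc)
qed

text \<open>
  If the second derivative were negative, the first one would be negative just to the right of the
  minimum, and the mean value theorem would produce a smaller value there.
\<close>

lemma deriv2_local_min:
  assumes "deriv2 g a d1 d2" "\<forall>\<^sub>F t in nhds a. g a \<le> g t"
  shows "d1 = 0" "0 \<le> d2"
proof -
  from assms(1) obtain g' where
    g: "\<forall>\<^sub>F t in nhds a. (g has_real_derivative g' t) (at t)" "g' a = d1"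
      "(g' has_real_derivative d2) (at a)"
    unfolding deriv2_def by blast
  from g(1) assms(2) have "\<forall>\<^sub>F t in nhds a. (g has_real_derivative g' t) (at t) \<and> g a \<le> g t"
    by eventually_elim auto
  then obtain e where e: "e > 0"
    "\<And>t. dist t a < e \<Longrightarrow> (g has_real_derivative g' t) (at t) \<and> g a \<le> g t"
    unfolding eventually_nhds_metric by blast
  show d1: "d1 = 0"
    using DERIV_local_min[of g d1 a e] e g(2) by (auto simp: dist_real_def abs_minus_commute)
  show "0 \<le> d2"
  proof (rule ccontr)
    assume "\<not> 0 \<le> d2"
    then have "d2 < 0" by simp
    from DERIV_neg_dec_right[OF g(3) this] obtain d where d: "d > 0"
      "\<And>h. 0 < h \<Longrightarrow> h < d \<Longrightarrow> g' (a + h) < g' a" by auto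
    define h where "h = min d e / 2"
    have h: "0 < h" "h < d" "h < e" using d(1) e(1) by (auto simp: h_def)
    have "\<exists>z. a < z \<and> z < a + h \<and> g (a + h) - g a = (a + h - a) * g' z"
      using h by (intro MVT2) (auto intro!: e(2)[THEN conjunct1] simp: dist_real_def)
    then obtain z where z: "a < z" "z < a + h" "g (a + h) - g a = h * g' z" by auto
    have "g' z < 0" using d(2)[of "z - a"] z h g(2) d1 by auto
    then have "g (a + h) < g a" using z(3) h(1) by (smt (verit) mult_pos_neg)
    moreover have "g a \<le> g (a + h)" using e(2)[of "a + h"] h by (auto simp: dist_real_def)
    ultimately show False by simp
  qed
qed

text \<open>
  \<open>G\<close> is the gradient and \<open>l\<close> the Laplacian of \<open>f\<close> at \<open>z\<close>, but differentiability is demanded only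
  along the coordinate lines through \<open>z\<close>.
\<close>

definition jet2 :: "('a::euclidean_space \<Rightarrow> real) \<Rightarrow> 'a \<Rightarrow> 'a \<Rightarrow> real \<Rightarrow> bool" where
  "jet2 f z G l \<longleftrightarrow> (\<exists>H. (\<forall>b\<in>Basis. deriv2 (\<lambda>t. f (z + t *\<^sub>R b)) 0 (G \<bullet> b) (H b)) \<and>
      l = (\<Sum>b\<in>Basis. H b))"

lemma jet2_eq: "jet2 f z G l \<Longrightarrow> G = G' \<Longrightarrow> l = l' \<Longrightarrow> jet2 f z G' l'"
  by simp

lemma jet2_add:
  assumes "jet2 f z G l" "jet2 g z G' l'"
  shows "jet2 (\<lambda>z. f z + g z) z (G + G') (l + l')"
proof -
  from assms obtain H H' where
    "\<forall>b\<in>Basis. deriv2 (\<lambda>t. f (z + t *\<^sub>R b)) 0 (G \<bullet> b) (H b)" "l = (\<Sum>b\<in>Basis. H b)"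
    "\<forall>b\<in>Basis. deriv2 (\<lambda>t. g (z + t *\<^sub>R b)) 0 (G' \<bullet> b) (H' b)" "l' = (\<Sum>b\<in>Basis. H' b)"
    unfolding jet2_def by blast
  then show ?thesis unfolding jet2_def
    by (intro exI[of _ "\<lambda>b. H b + H' b"]) (auto simp: sum.distrib inner_add_left intro!: deriv2_add)
qed

lemma jet2_mult:
  assumes "jet2 f z G l" "jet2 g z G' l'"
  shows "jet2 (\<lambda>z. f z * g z) z (g z *\<^sub>R G + f z *\<^sub>R G') (l * g z + 2 * (G \<bullet> G') + l' * f z)"
proof -
  from assms obtain H H' where
    H: "\<forall>b\<in>Basis. deriv2 (\<lambda>t. f (z + t *\<^sub>R b)) 0 (G \<bullet> b) (H b)" "l = (\<Sum>b\<in>Basis. H b)"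
    "\<forall>b\<in>Basis. deriv2 (\<lambda>t. g (z + t *\<^sub>R b)) 0 (G' \<bullet> b) (H' b)" "l' = (\<Sum>b\<in>Basis. H' b)"
    unfolding jet2_def by blast
  show ?thesis unfolding jet2_def
  proof (intro exI[of _ "\<lambda>b. H b * g z + 2 * (G \<bullet> b) * (G' \<bullet> b) + H' b * f z"] conjI ballI)
    fix b :: 'a assume b: "b \<in> Basis"
    show "deriv2 (\<lambda>t. f (z + t *\<^sub>R b) * g (z + t *\<^sub>R b)) 0 ((g z *\<^sub>R G + f z *\<^sub>R G') \<bullet> b)
         (H b * g z + 2 * (G \<bullet> b) * (G' \<bullet> b) + H' b * f z)"
      using deriv2_mult[OF H(1)[rule_format, OF b] H(3)[rule_format, OF b]]
      by (simp add: inner_add_left mult_ac)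
  next
    show "l * g z + 2 * (G \<bullet> G') + l' * f z =
        (\<Sum>b\<in>Basis. H b * g z + 2 * (G \<bullet> b) * (G' \<bullet> b) + H' b * f z)"
      unfolding H sum.distrib sum_distrib_right euclidean_inner[of G G'] sum_distrib_left
      by (simp add: mult_ac)
  qed
qed

lemma jet2_compose:
  assumes "jet2 f z G l" "deriv2 F (f z) F1 F2"
  shows "jet2 (\<lambda>z. F (f z)) z (F1 *\<^sub>R G) (F2 * (G \<bullet> G) + F1 * l)"
proof -
  from assms obtain H where
    H: "\<forall>b\<in>Basis. deriv2 (\<lambda>t. f (z + t *\<^sub>R b)) 0 (G \<bullet> b) (H b)" "l = (\<Sum>b\<in>Basis. H b)"
    unfolding jet2_def by blast
  show ?thesis unfolding jet2_def
  proof (intro exI[of _ "\<lambda>b. F2 * (G \<bullet> b)\<^sup>2 + F1 * H b"] conjI ballI)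
    fix b :: 'a assume b: "b \<in> Basis"
    show "deriv2 (\<lambda>t. F (f (z + t *\<^sub>R b))) 0 ((F1 *\<^sub>R G) \<bullet> b) (F2 * (G \<bullet> b)\<^sup>2 + F1 * H b)"
      using deriv2_compose[OF H(1)[rule_format, OF b], of F F1 F2] assms(2) by simp
  next
    show "F2 * (G \<bullet> G) + F1 * l = (\<Sum>b\<in>Basis. F2 * (G \<bullet> b)\<^sup>2 + F1 * H b)"
      unfolding H sum.distrib sum_distrib_right euclidean_inner[of G G] sum_distrib_left
      by (simp add: power2_eq_square)
  qed
qed

lemma jet2_affine: "jet2 (\<lambda>z. c + d \<bullet> z) z d 0"
  unfolding jet2_def
proof (intro exI[of _ "\<lambda>_. 0"] conjI ballI)
  fix b :: 'a
  have "deriv2 (\<lambda>t. (c + d \<bullet> z) + (d \<bullet> b) * t + 0 * t\<^sup>2) 0 (d \<bullet> b) (2 * 0)"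
    by (rule deriv2_quadratic)
  then show "deriv2 (\<lambda>t. c + d \<bullet> (z + t *\<^sub>R b)) 0 (d \<bullet> b) 0"
    by (simp add: inner_add_right algebra_simps)
qed simp

lemma jet2_const: "jet2 (\<lambda>z. c) z 0 0"
  using jet2_affine[of c 0 z] by simp

lemma jet2_cmult:
  assumes "jet2 f z G l"
  shows "jet2 (\<lambda>z. c * f z) z (c *\<^sub>R G) (c * l)"
  using jet2_mult[OF jet2_const[of c z] assms] by (simp add: mult_ac)

lemma jet2_local_min:
  assumes "jet2 f z G l" "\<forall>\<^sub>F z' in nhds z. f z \<le> f z'"
  shows "G = 0" "0 \<le> l"
proof -
  from assms obtain H where
    H: "\<forall>b\<in>Basis. deriv2 (\<lambda>t. f (z + t *\<^sub>R b)) 0 (G \<bullet> b) (H b)" "l = (\<Sum>b\<in>Basis. H b)"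
    unfolding jet2_def by blast
  have *: "G \<bullet> b = 0" "0 \<le> H b" if b: "b \<in> Basis" for b
  proof -
    have "((\<lambda>t. z + t *\<^sub>R b) \<longlongrightarrow> z + 0 *\<^sub>R b) (nhds 0)"
      by (intro tendsto_intros filterlim_ident)
    then have "filterlim (\<lambda>t. z + t *\<^sub>R b) (nhds z) (nhds 0)" by simp
    then have "\<forall>\<^sub>F t in nhds 0. f z \<le> f (z + t *\<^sub>R b)"
      by (rule eventually_compose_filterlim[OF assms(2)])
    then have "\<forall>\<^sub>F t in nhds 0. f (z + 0 *\<^sub>R b) \<le> f (z + t *\<^sub>R b)" by simp
    from deriv2_local_min[OF H(1)[rule_format, OF b] this]
    show "G \<bullet> b = 0" "0 \<le> H b" by auto
  qed
  show "G = 0" by (rule euclidean_eqI) (simp add: *(1))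
  show "0 \<le> l" unfolding H(2) using *(2) by (rule sum_nonneg)
qed

section \<open>The extension operator, its conormal derivative and the minimum principle\<close>

text \<open>
  The value \<open>v\<close> of the non-divergence form \<open>\<Delta> f + (1 - \<alpha>) / y * \<partial>\<^sub>y f\<close> of the extension operator.
\<close>

definition cs_op :: "real \<Rightarrow> ((real^'n) \<times> real \<Rightarrow> real) \<Rightarrow> (real^'n) \<times> real \<Rightarrow> real \<Rightarrow> bool" where
  "cs_op \<alpha> f z v \<longleftrightarrow> (\<exists>G l. jet2 f z G l \<and> v = l + (1 - \<alpha>) / snd z * snd G)"

lemma cs_opI: "jet2 f z G l \<Longrightarrow> v = l + (1 - \<alpha>) / snd z * snd G \<Longrightarrow> cs_op \<alpha> f z v"
  unfolding cs_op_def by blast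

lemma cs_op_add:
  assumes "cs_op \<alpha> f z v" "cs_op \<alpha> g z v'"
  shows "cs_op \<alpha> (\<lambda>z. f z + g z) z (v + v')"
proof -
  from assms obtain G l G' l' where
    "jet2 f z G l" "v = l + (1 - \<alpha>) / snd z * snd G"
    "jet2 g z G' l'" "v' = l' + (1 - \<alpha>) / snd z * snd G'"
    unfolding cs_op_def by blast
  then show ?thesis by (intro cs_opI[OF jet2_add[of f z G l g G' l']]) (auto simp: algebra_simps diff_divide_distrib add_divide_distrib)
qed

lemma cs_op_cmult:
  assumes "cs_op \<alpha> f z v"
  shows "cs_op \<alpha> (\<lambda>z. c * f z) z (c * v)"
proof -
  from assms obtain G l where
    "jet2 f z G l" "v = l + (1 - \<alpha>) / snd z * snd G"
    unfolding cs_op_def by blast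
  then show ?thesis by (intro cs_opI[OF jet2_cmult[of f z G l]]) (auto simp: algebra_simps)
qed

lemma cs_op_const: "cs_op \<alpha> (\<lambda>z. c) z 0"
  by (rule cs_opI[OF jet2_const]) simp

lemma jet2_snd: "jet2 (snd :: (real^'n) \<times> real \<Rightarrow> real) z (0, 1) 0"
  using jet2_affine[of 0 "(0, 1) :: (real^'n) \<times> real" z] by (simp add: inner_prod_def)

lemma jet2_fst_component:
  "jet2 (\<lambda>z :: (real^'n) \<times> real. c - fst z $ k) z (- axis k 1, 0) 0"
  using jet2_affine[of c "(- axis k 1, 0) :: (real^'n) \<times> real" z]
  by (simp add: inner_prod_def inner_axis')

lemma Basis_half_space:
  "(\<Sum>b\<in>(Basis :: ((real^'n) \<times> real) set). f b) = (\<Sum>b\<in>Basis. f (b, 0)) + f (0, 1)"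
proof -
  have "(\<Sum>b\<in>(Basis :: ((real^'n) \<times> real) set). f b)
      = (\<Sum>b\<in>(\<lambda>u. (u, 0)) ` Basis. f b) + (\<Sum>b\<in>(\<lambda>v. (0, v)) ` Basis. f b)"
    unfolding Basis_prod_def by (rule sum.union_disjoint) auto
  then show ?thesis by (simp add: sum.reindex inj_on_def)
qed

lemma jet2_norm_fst:
  "jet2 (\<lambda>z :: (real^'n) \<times> real. (norm (fst z - x0))\<^sup>2) z (2 *\<^sub>R (fst z - x0), 0) (2 * real CARD('n))"
  unfolding jet2_def
proof (intro exI[of _ "\<lambda>b. 2 * (fst b \<bullet> fst b)"] conjI ballI)
  fix b :: "(real^'n) \<times> real"
  have "deriv2 (\<lambda>t. (norm (fst z - x0))\<^sup>2 + (2 * ((fst z - x0) \<bullet> fst b)) * t + (fst b \<bullet> fst b) * t\<^sup>2)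
     0 (2 * ((fst z - x0) \<bullet> fst b)) (2 * (fst b \<bullet> fst b))"
    by (rule deriv2_quadratic)
  moreover have "(norm (fst z - x0))\<^sup>2 + (2 * ((fst z - x0) \<bullet> fst b)) * t + (fst b \<bullet> fst b) * t\<^sup>2
      = (norm (fst (z + t *\<^sub>R b) - x0))\<^sup>2" for t
    unfolding power2_norm_eq_inner
    by (simp add: inner_add_left inner_add_right inner_diff_left inner_diff_right
        inner_commute power2_eq_square algebra_simps)
  ultimately show "deriv2 (\<lambda>t. (norm (fst (z + t *\<^sub>R b) - x0))\<^sup>2) 0
      ((2 *\<^sub>R (fst z - x0), 0) \<bullet> b) (2 * (fst b \<bullet> fst b))"
    by (simp add: inner_prod_def)
next
  show "2 * real CARD('n) = (\<Sum>b\<in>(Basis :: ((real^'n) \<times> real) set). 2 * (fst b \<bullet> fst b))"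
    unfolding Basis_half_space by (simp add: inner_Basis)
qed

text \<open>
  The functions \<open>1\<close> and \<open>y powr \<alpha>\<close> span the solutions that depend on the height alone. The second
  one is the tool for prescribing a flux: its conormal derivative is the constant \<open>- \<alpha>\<close>.
\<close>

lemma cs_op_height_powr:
  assumes "snd z > 0"
  shows "cs_op \<alpha> (\<lambda>z :: (real^'n) \<times> real. snd z powr \<alpha>) z 0"
  using assms
  by (intro cs_opI[OF jet2_compose[OF jet2_snd deriv2_powr[OF assms, of \<alpha>]]])
     (simp add: field_simps power2_eq_square)

lemma jet2_square:
  assumes "jet2 f z G l"
  shows "jet2 (\<lambda>z. (f z)\<^sup>2) z ((2 * f z) *\<^sub>R G) (2 * (G \<bullet> G) + 2 * f z * l)"
  using jet2_mult[OF assms assms] by (simp add: power2_eq_square algebra_simps scaleR_add_left[symmetric])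

lemma cs_op_height_square:
  assumes "snd z > 0"
  shows "cs_op \<alpha> (\<lambda>z :: (real^'n) \<times> real. (snd z)\<^sup>2) z (2 * (2 - \<alpha>))"
  using assms by (intro cs_opI[OF jet2_square[OF jet2_snd]]) (simp add: field_simps)

lemma cs_op_norm_fst:
  "cs_op \<alpha> (\<lambda>z :: (real^'n) \<times> real. (norm (fst z - x0))\<^sup>2) z (2 * real CARD('n))"
  by (intro cs_opI[OF jet2_norm_fst]) simp

lemma cs_op_fst_component:
  "cs_op \<alpha> (\<lambda>z :: (real^'n) \<times> real. c - fst z $ k) z 0"
  by (intro cs_opI[OF jet2_fst_component]) simp

lemma cs_op_fst_component_square:
  "cs_op \<alpha> (\<lambda>z :: (real^'n) \<times> real. (c - fst z $ k)\<^sup>2) z 2"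
  by (intro cs_opI[OF jet2_square[OF jet2_fst_component]]) (simp add: inner_axis_axis)

definition conormal :: "real \<Rightarrow> ((real^'n) \<times> real \<Rightarrow> real) \<Rightarrow> real^'n \<Rightarrow> real \<Rightarrow> bool" where
  "conormal \<alpha> f x \<nu> \<longleftrightarrow> (\<exists>D. (\<forall>\<^sub>F y in at_right 0. ((\<lambda>t. f (x, t)) has_real_derivative D y) (at y)) \<and>
      ((\<lambda>y. - (y powr (1 - \<alpha>) * D y)) \<longlongrightarrow> \<nu>) (at_right 0))"

lemma conormalI:
  assumes "\<And>y. 0 < y \<Longrightarrow> ((\<lambda>t. f (x, t)) has_real_derivative D y) (at y)"
    and "((\<lambda>y. - (y powr (1 - \<alpha>) * D y)) \<longlongrightarrow> \<nu>) (at_right 0)"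
  shows "conormal \<alpha> f x \<nu>"
  using assms unfolding conormal_def by (auto simp: eventually_at_right_less intro!: exI[of _ D]
     eventually_mono[OF eventually_at_right_less[of 0]])

lemma conormal_add:
  assumes "conormal \<alpha> f x \<nu>" "conormal \<alpha> g x \<nu>'"
  shows "conormal \<alpha> (\<lambda>z. f z + g z) x (\<nu> + \<nu>')"
proof -
  from assms obtain D D' where
    D: "\<forall>\<^sub>F y in at_right 0. ((\<lambda>t. f (x, t)) has_real_derivative D y) (at y)"
      "((\<lambda>y. - (y powr (1 - \<alpha>) * D y)) \<longlongrightarrow> \<nu>) (at_right 0)"
      "\<forall>\<^sub>F y in at_right 0. ((\<lambda>t. g (x, t)) has_real_derivative D' y) (at y)"
      "((\<lambda>y. - (y powr (1 - \<alpha>) * D' y)) \<longlongrightarrow> \<nu>') (at_right 0)"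
    unfolding conormal_def by blast
  have "\<forall>\<^sub>F y in at_right 0. ((\<lambda>t. f (x, t) + g (x, t)) has_real_derivative D y + D' y) (at y)"
    using D(1,3) by eventually_elim (rule DERIV_add)
  moreover have "((\<lambda>y. - (y powr (1 - \<alpha>) * (D y + D' y))) \<longlongrightarrow> \<nu> + \<nu>') (at_right 0)"
    using tendsto_add[OF D(2,4)] by (simp add: algebra_simps)
  ultimately show ?thesis unfolding conormal_def by (intro exI[of _ "\<lambda>y. D y + D' y"] conjI)
qed

lemma conormal_cmult:
  assumes "conormal \<alpha> f x \<nu>"
  shows "conormal \<alpha> (\<lambda>z. c * f z) x (c * \<nu>)"
proof -
  from assms obtain D where
    D: "\<forall>\<^sub>F y in at_right 0. ((\<lambda>t. f (x, t)) has_real_derivative D y) (at y)"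
      "((\<lambda>y. - (y powr (1 - \<alpha>) * D y)) \<longlongrightarrow> \<nu>) (at_right 0)"
    unfolding conormal_def by blast
  have "\<forall>\<^sub>F y in at_right 0. ((\<lambda>t. c * f (x, t)) has_real_derivative c * D y) (at y)"
    using D(1) by eventually_elim (rule DERIV_cmult)
  moreover have "((\<lambda>y. - (y powr (1 - \<alpha>) * (c * D y))) \<longlongrightarrow> c * \<nu>) (at_right 0)"
    using tendsto_mult_left[OF D(2), of c] by (simp add: algebra_simps)
  ultimately show ?thesis unfolding conormal_def by (intro exI[of _ "\<lambda>y. c * D y"] conjI)
qed

lemma conormal_fst: "conormal \<alpha> (\<lambda>z. f (fst z)) x 0"
  by (rule conormalI[where D = "\<lambda>_. 0"]) auto

lemma conormal_height_powr: "conormal \<alpha> (\<lambda>z. snd z powr \<alpha>) x (- \<alpha>)"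
proof (rule conormalI[where D = "\<lambda>y. \<alpha> * y powr (\<alpha> - 1)"])
  show "0 < y \<Longrightarrow> ((\<lambda>t. snd (x, t) powr \<alpha>) has_real_derivative \<alpha> * y powr (\<alpha> - 1)) (at y)" for y
    by (simp add: has_real_derivative_powr)
  have "\<forall>\<^sub>F y in at_right 0. - \<alpha> = - (y powr (1 - \<alpha>) * (\<alpha> * y powr (\<alpha> - 1)))"
    using eventually_at_right_less[of "0::real"]
    by eventually_elim (simp add: powr_add[symmetric])
  then show "((\<lambda>y. - (y powr (1 - \<alpha>) * (\<alpha> * y powr (\<alpha> - 1)))) \<longlongrightarrow> - \<alpha>) (at_right 0)"
    by (rule Lim_transform_eventually[OF tendsto_const])
qed

lemma powr_at_right_0:
  assumes "0 < (r::real)"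
  shows "((\<lambda>y::real. y powr r) \<longlongrightarrow> 0) (at_right 0)"
proof (rule tendsto_zero_powrI[where b = r])
  show "\<forall>\<^sub>F y in at_right 0. (0::real) \<le> y"
    using eventually_at_right_less[of "0::real"] by eventually_elim simp
qed (use assms in auto)

lemma conormal_height_square:
  assumes "\<alpha> < 2"
  shows "conormal \<alpha> (\<lambda>z. (snd z)\<^sup>2) x 0"
proof (rule conormalI[where D = "\<lambda>y. 2 * y"])
  show "0 < y \<Longrightarrow> ((\<lambda>t. (snd (x, t))\<^sup>2) has_real_derivative 2 * y) (at y)" for y
    by (auto intro!: derivative_eq_intros)
  have "((\<lambda>y. - 2 * y powr (2 - \<alpha>)) \<longlongrightarrow> - 2 * 0) (at_right 0)"
    using assms by (intro tendsto_intros powr_at_right_0) auto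
  moreover have "\<forall>\<^sub>F y in at_right 0. - 2 * y powr (2 - \<alpha>) = - (y powr (1 - \<alpha>) * (2 * y))"
    using eventually_at_right_less[of "0::real"]
  proof eventually_elim
    case (elim y)
    then show ?case using powr_mult_base[of y "1 - \<alpha>"] by (simp add: mult_ac)
  qed
  ultimately show "((\<lambda>y. - (y powr (1 - \<alpha>) * (2 * y))) \<longlongrightarrow> 0) (at_right 0)"
    using Lim_transform_eventually by fastforce
qed

text \<open>
  A positive flux makes \<open>f\<close> strictly decreasing in \<open>y\<close> near \<open>y = 0\<close>.
\<close>

lemma conormal_boundary_min:
  assumes "conormal \<alpha> f x \<nu>" "\<forall>\<^sub>F y in at_right 0. f (x, 0) \<le> f (x, y)"
    and "((\<lambda>y. f (x, y)) \<longlongrightarrow> f (x, 0)) (at_right 0)"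
  shows "\<nu> \<le> 0"
proof (rule ccontr)
  assume "\<not> \<nu> \<le> 0"
  from assms(1) obtain D where
    D: "\<forall>\<^sub>F y in at_right 0. ((\<lambda>t. f (x, t)) has_real_derivative D y) (at y)"
      "((\<lambda>y. - (y powr (1 - \<alpha>) * D y)) \<longlongrightarrow> \<nu>) (at_right 0)"
    unfolding conormal_def by blast
  have "\<forall>\<^sub>F y in at_right 0. - (y powr (1 - \<alpha>) * D y) > 0"
    using order_tendstoD(1)[OF D(2), of 0] \<open>\<not> \<nu> \<le> 0\<close> by simp
  with D(1) assms(2) have "\<forall>\<^sub>F y in at_right 0. ((\<lambda>t. f (x, t)) has_real_derivative D y) (at y) \<and>
      D y < 0 \<and> f (x, 0) \<le> f (x, y)"
    by eventually_elim (auto simp: mult_less_0_iff not_less[symmetric])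
  then obtain e where e: "e > 0"
    "\<And>y. 0 < y \<Longrightarrow> y < e \<Longrightarrow> ((\<lambda>t. f (x, t)) has_real_derivative D y) (at y) \<and>
      D y < 0 \<and> f (x, 0) \<le> f (x, y)"
    unfolding eventually_at_right_field by auto
  have dec: "f (x, b) < f (x, a)" if "0 < a" "a < b" "b < e" for a b
    using that e(2) by (intro DERIV_neg_imp_decreasing[of a b "\<lambda>t. f (x, t)"]) 
      (meson less_le_trans order.strict_trans1)+
  have "f (x, e/2) < f (x, e/3)" using dec[of "e/3" "e/2"] e(1) by simp
  moreover have "f (x, e/3) \<le> f (x, 0)"
  proof (rule tendsto_lowerbound[OF assms(3)])
    show "\<forall>\<^sub>F y in at_right 0. f (x, e/3) \<le> f (x, y)"
      unfolding eventually_at_right_field using dec e(1)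
      by (intro exI[of _ "e/3"]) (auto intro!: less_imp_le)
  qed simp
  moreover have "f (x, 0) \<le> f (x, e/2)" using e(2)[of "e/2"] e(1) by simp
  ultimately show False by simp
qed

text \<open>
  The form of the maximum principle used throughout: a function that is a strict supersolution at
  \<open>z\<close>, in the sense of the operator inside and of the flux on \<open>y = 0\<close>, has no minimum there.
\<close>

lemma min_principle:
  fixes F :: "(real^'n) \<times> real \<Rightarrow> real"
  assumes "open U" "z \<in> U" "snd z \<ge> 0"
    and min: "\<And>z'. z' \<in> U \<Longrightarrow> snd z' \<ge> 0 \<Longrightarrow> F z \<le> F z'"
    and A: "U \<inter> {z'. snd z' \<ge> 0} \<subseteq> A" and cont: "continuous_on A F"
    and int: "snd z > 0 \<Longrightarrow> \<exists>v<0. cs_op \<alpha> F z v"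
    and bd: "snd z = 0 \<Longrightarrow> \<exists>\<nu>>0. conormal \<alpha> F (fst z) \<nu>"
  shows False
proof (cases "snd z > 0")
  case True
  from int[OF True] obtain v G l where v: "v < 0" "jet2 F z G l" "v = l + (1 - \<alpha>) / snd z * snd G"
    unfolding cs_op_def by blast
  have "open (U \<inter> {z. 0 < snd z})"
    using assms(1) by (intro open_Int open_Collect_less continuous_intros) auto
  then have "\<forall>\<^sub>F z' in nhds z. z' \<in> U \<inter> {z. 0 < snd z}"
    by (rule eventually_nhds_in_open) (use assms True in auto)
  then have "\<forall>\<^sub>F z' in nhds z. F z \<le> F z'"
    by eventually_elim (auto intro!: min)
  from jet2_local_min[OF v(2) this] v show False by simp
next
  case False
  then have z0: "snd z = 0" and zeq: "z = (fst z, 0)" using assms(3) by (auto simp: prod_eq_iff)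
  from bd[OF z0] obtain \<nu> where nu: "\<nu> > 0" "conormal \<alpha> F (fst z) \<nu>" by blast
  have lim: "((\<lambda>y. (fst z, y)) \<longlongrightarrow> (fst z, 0)) (at_right 0)"
    by (intro tendsto_intros)
  have inU: "\<forall>\<^sub>F y in at_right 0. (fst z, y) \<in> U"
    using topological_tendstoD[OF lim assms(1)] assms(2) zeq by simp
  with eventually_at_right_less[of "0::real"] have 1: "\<forall>\<^sub>F y in at_right 0. F (fst z, 0) \<le> F (fst z, y)"
    by eventually_elim (use min zeq in auto)
  have "filterlim (\<lambda>y. (fst z, y)) (at z within A) (at_right 0)"
    unfolding filterlim_at
  proof
    show "\<forall>\<^sub>F y in at_right 0. (fst z, y) \<in> A \<and> (fst z, y) \<noteq> z"
      using inU eventually_at_right_less[of "0::real"]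
      by eventually_elim (use A z0 in \<open>auto simp: prod_eq_iff\<close>)
    show "filterlim (\<lambda>y. (fst z, y)) (nhds z) (at_right 0)"
      by (subst (2) zeq) (rule lim)
  qed
  moreover have "(F \<longlongrightarrow> F z) (at z within A)"
    using cont A assms(2,3) unfolding continuous_on_def by auto
  ultimately have "((\<lambda>y. F (fst z, y)) \<longlongrightarrow> F z) (at_right 0)"
    by (rule filterlim_compose[rotated])
  then have "((\<lambda>y. F (fst z, y)) \<longlongrightarrow> F (fst z, 0)) (at_right 0)" using zeq by simp
  from conormal_boundary_min[OF nu(2) 1 this] nu(1) show False by simp
qed

section \<open>Extensions and their reflections\<close>

lemma GDERIV_gradient:
  assumes "f differentiable (at z)"
  shows "GDERIV f z :> gradient f z"
proof -
  from assms obtain f' where f': "(f has_derivative f') (at z)"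
    unfolding differentiable_def by blast
  interpret linear f' using f' by (rule has_derivative_linear)
  have "f' h = h \<bullet> (\<Sum>b\<in>Basis. f' b *\<^sub>R b)" for h
  proof -
    have "f' h = f' (\<Sum>b\<in>Basis. (h \<bullet> b) *\<^sub>R b)" by (simp add: euclidean_representation)
    then show ?thesis by (simp add: sum scale inner_sum_right mult.commute)
  qed
  then have eq: "f' = (\<lambda>h. h \<bullet> (\<Sum>b\<in>Basis. f' b *\<^sub>R b))" by (rule ext)
  have ex: "GDERIV f z :> (\<Sum>b\<in>Basis. f' b *\<^sub>R b)"
    unfolding gderiv_def by (rule has_derivative_eq_rhs[OF f' eq])
  have un: "D = D'" if D: "GDERIV f z :> D" "GDERIV f z :> D'" for D D'
  proof -
    have "h \<bullet> D = h \<bullet> D'" for h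
      using has_derivative_unique[OF D[unfolded gderiv_def]] by (rule fun_cong)
    then show ?thesis using vector_eq_ldot[of D D'] by simp
  qed
  show ?thesis
    unfolding gradient_def
    by (rule theI[where P = "\<lambda>D. GDERIV f z :> D", OF ex]) (erule un[OF _ ex])
qed

lemma C2_on_jet2:
  assumes "C2_on f S" "open S" "z \<in> S"
  shows "jet2 f z (gradient f z) (\<Sum>b\<in>Basis. frechet_derivative (gradient f) (at z) b \<bullet> b)"
  unfolding jet2_def
proof (intro exI[of _ "\<lambda>b. frechet_derivative (gradient f) (at z) b \<bullet> b"] conjI ballI refl)
  fix b :: 'a assume "b \<in> Basis"
  have lim: "((\<lambda>t. z + t *\<^sub>R b) \<longlongrightarrow> z + 0 *\<^sub>R b) (nhds 0)"
    by (intro tendsto_intros filterlim_ident)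
  have 1: "\<forall>\<^sub>F t in nhds 0. z + t *\<^sub>R b \<in> S"
    using topological_tendstoD[OF lim assms(2)] assms(3) by simp
  then have 1: "\<forall>\<^sub>F t in nhds 0. ((\<lambda>t. f (z + t *\<^sub>R b)) has_real_derivative
      gradient f (z + t *\<^sub>R b) \<bullet> b) (at t)"
  proof eventually_elim
    case (elim t)
    then have "f differentiable (at (z + t *\<^sub>R b))"
      using assms(1) unfolding C2_on_def C1_on_def by blast
    then have "(f has_derivative (\<lambda>h. h \<bullet> gradient f (z + t *\<^sub>R b))) (at (z + t *\<^sub>R b))"
      using GDERIV_gradient unfolding gderiv_def by blast
    moreover have "((\<lambda>t. z + t *\<^sub>R b) has_derivative (\<lambda>h. h *\<^sub>R b)) (at t)"
      by (auto intro!: derivative_eq_intros)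
    ultimately have "((\<lambda>t. f (z + t *\<^sub>R b)) has_derivative
        (\<lambda>h. (h *\<^sub>R b) \<bullet> gradient f (z + t *\<^sub>R b))) (at t)"
      by (rule has_derivative_compose[rotated, where g = f])
    then show ?case
      unfolding has_field_derivative_def
      by (rule has_derivative_eq_rhs) (simp add: fun_eq_iff inner_commute)
  qed
  have "(gradient f has_derivative frechet_derivative (gradient f) (at z)) (at z)"
    using assms unfolding C2_on_def C1_on_def by (metis frechet_derivative_works)
  then have D: "(gradient f has_derivative frechet_derivative (gradient f) (at z)) (at (z + 0 *\<^sub>R b))"
    by simp
  interpret L: linear "frechet_derivative (gradient f) (at z)"
    using D by (rule has_derivative_linear)
  have "((\<lambda>t. gradient f (z + t *\<^sub>R b)) has_derivative
      (\<lambda>h. frechet_derivative (gradient f) (at z) (h *\<^sub>R b))) (at 0)"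
    by (rule has_derivative_compose[where f = "\<lambda>t. z + t *\<^sub>R b" and g = "gradient f", OF _ D])
       (auto intro!: derivative_eq_intros)
  then have "((\<lambda>t. gradient f (z + t *\<^sub>R b) \<bullet> b) has_derivative
      (\<lambda>h. frechet_derivative (gradient f) (at z) (h *\<^sub>R b) \<bullet> b)) (at 0)"
    by (rule has_derivative_inner_left)
  then have "((\<lambda>t. gradient f (z + t *\<^sub>R b) \<bullet> b) has_real_derivative
      frechet_derivative (gradient f) (at z) b \<bullet> b) (at 0)"
    unfolding has_field_derivative_def
    by (rule has_derivative_eq_rhs) (simp add: fun_eq_iff L.scale)
  from deriv2I[OF 1 this]
  show "deriv2 (\<lambda>t. f (z + t *\<^sub>R b)) 0 (gradient f z \<bullet> b)
     (frechet_derivative (gradient f) (at z) b \<bullet> b)" by simp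
qed

lemma open_upper: "open {z :: 'a::topological_space \<times> real. 0 < snd z}"
  by (intro open_Collect_less continuous_intros)

text \<open>
  Expanding the divergence with the product rule gives \<open>y powr (1 - \<alpha>)\<close> times \<open>cs_op\<close>.
\<close>

lemma cs_extension_op:
  assumes w: "cs_extension \<alpha> u w" and z: "snd z > 0"
  shows "cs_op \<alpha> w z 0"
proof -
  have "divergence (\<lambda>\<zeta>. snd \<zeta> powr (1 - \<alpha>) *\<^sub>R gradient w \<zeta>) z = 0"
  proof -
    have "\<forall>z. snd z > 0 \<longrightarrow> - divergence (\<lambda>\<zeta>. snd \<zeta> powr (1 - \<alpha>) *\<^sub>R gradient w \<zeta>) z = 0"
      using w unfolding cs_extension_def by blast
    with z show ?thesis by fastforce
  qed
  moreover define y where "y = snd z"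
  moreover define g where "g = gradient w"
  ultimately have div0: "divergence (\<lambda>\<zeta>. snd \<zeta> powr (1 - \<alpha>) *\<^sub>R g \<zeta>) z = 0" by simp
  define D where "D = frechet_derivative g (at z)"
  have y: "y > 0" using z by (simp add: y_def)
  have C2: "C2_on w {z. snd z > 0}" using w by (simp add: cs_extension_def)
  have gD: "(g has_derivative D) (at z)"
    using C2 z unfolding C2_on_def C1_on_def g_def D_def by (metis frechet_derivative_works mem_Collect_eq)
  have "((\<lambda>\<zeta>. snd \<zeta> powr (1 - \<alpha>)) has_derivative (\<lambda>h. (1 - \<alpha>) * y powr (- \<alpha>) * snd h)) (at z)"
  proof -
    have "((\<lambda>t. t powr (1 - \<alpha>)) has_derivative (\<lambda>h. ((1 - \<alpha>) * y powr (- \<alpha>)) * h)) (at (snd z))"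
      using has_real_derivative_powr[OF y, of "1 - \<alpha>"]
      unfolding has_field_derivative_def y_def by simp
    from has_derivative_compose[where f = snd and f' = snd, OF _ this] show ?thesis
      using has_derivative_snd[OF has_derivative_ident] by blast
  qed
  from has_derivative_scaleR[OF this gD]
  have "((\<lambda>\<zeta>. snd \<zeta> powr (1 - \<alpha>) *\<^sub>R g \<zeta>) has_derivative
      (\<lambda>h. y powr (1 - \<alpha>) *\<^sub>R D h + ((1 - \<alpha>) * y powr (- \<alpha>) * snd h) *\<^sub>R g z)) (at z)"
    by (simp add: y_def)
  note fd = frechet_derivative_at[OF this]
  have "divergence (\<lambda>\<zeta>. snd \<zeta> powr (1 - \<alpha>) *\<^sub>R g \<zeta>) z =
     (\<Sum>b\<in>Basis. (y powr (1 - \<alpha>) *\<^sub>R D b + ((1 - \<alpha>) * y powr (- \<alpha>) * snd b) *\<^sub>R g z) \<bullet> b)"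
    unfolding divergence_def by (simp only: fd[symmetric])
  also have "\<dots> = y powr (1 - \<alpha>) * (\<Sum>b\<in>Basis. D b \<bullet> b)
      + ((1 - \<alpha>) * y powr (- \<alpha>)) * (\<Sum>b\<in>Basis. snd b * (g z \<bullet> b))"
    by (simp add: inner_add_left sum.distrib sum_distrib_left mult_ac del: inner_Pair)
  also have "(\<Sum>b\<in>Basis. snd b * (g z \<bullet> b)) = (\<Sum>b\<in>Basis. ((0, 1) \<bullet> b) * (g z \<bullet> b))"
    by (intro sum.cong) (auto simp: inner_prod_def)
  also have "\<dots> = snd (g z)"
    unfolding euclidean_inner[symmetric] by (simp add: inner_prod_def)
  also have "y powr (1 - \<alpha>) * (\<Sum>b\<in>Basis. D b \<bullet> b) + ((1 - \<alpha>) * y powr (- \<alpha>)) * snd (g z)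
      = y powr (1 - \<alpha>) * ((\<Sum>b\<in>Basis. D b \<bullet> b) + (1 - \<alpha>) / y * snd (g z))"
    using y by (simp add: powr_diff powr_minus field_simps)
  finally have "y powr (1 - \<alpha>) * ((\<Sum>b\<in>Basis. D b \<bullet> b) + (1 - \<alpha>) / y * snd (g z)) = 0"
    using div0 by simp
  then have "(\<Sum>b\<in>Basis. D b \<bullet> b) + (1 - \<alpha>) / y * snd (g z) = 0"
    using y by (simp only: mult_eq_0_iff powr_eq_0_iff) simp
  then show ?thesis
    using cs_opI[OF C2_on_jet2[OF C2 open_upper], of z 0] z unfolding D_def g_def y_def by simp
qed

definition reflect :: "real \<Rightarrow> 'n \<Rightarrow> real^'n \<Rightarrow> real^'n" where
  "reflect \<mu> k x = x + (2 * (\<mu> - x $ k)) *\<^sub>R axis k 1"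

lemma reflect_nth: "reflect \<mu> k x $ i = (if i = k then 2 * \<mu> - x $ k else x $ i)"
  by (simp add: reflect_def axis_def)

text \<open>
  Reversing one coordinate direction leaves its second derivative and the \<open>y\<close>-derivative unchanged.
\<close>

lemma cs_op_reflect:
  fixes f :: "(real^'n) \<times> real \<Rightarrow> real"
  assumes "cs_op \<alpha> f (reflect \<mu> k (fst z), snd z) v"
  shows "cs_op \<alpha> (\<lambda>z. f (reflect \<mu> k (fst z), snd z)) z v"
proof -
  define T :: "(real^'n) \<times> real \<Rightarrow> (real^'n) \<times> real" where "T = (\<lambda>z. (reflect \<mu> k (fst z), snd z))"
  from assms obtain G l where G: "jet2 f (T z) G l" and v: "v = l + (1 - \<alpha>) / snd z * snd G"
    unfolding cs_op_def T_def by auto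
  from G obtain H where
    H: "\<And>b. b \<in> Basis \<Longrightarrow> deriv2 (\<lambda>t. f (T z + t *\<^sub>R b)) 0 (G \<bullet> b) (H b)" "l = (\<Sum>b\<in>Basis. H b)"
    unfolding jet2_def by blast
  define \<epsilon> where "\<epsilon> b = (if b = (axis k 1, 0) then -1 else 1 :: real)" for b :: "(real^'n) \<times> real"
  define G' where "G' = (reflect 0 k (fst G), snd G)"
  have "jet2 (\<lambda>z. f (T z)) z G' l"
    unfolding jet2_def
  proof (intro exI[of _ H] conjI ballI H(2))
    fix b :: "(real^'n) \<times> real" assume b: "b \<in> Basis"
    then consider i where "b = (axis i 1, 0)" | "b = (0, 1)"
      by (auto simp: Basis_prod_def Basis_vec_def)
    then have *: "(\<forall>t. T (z + t *\<^sub>R b) = T z + (\<epsilon> b * t) *\<^sub>R b) \<and> G' \<bullet> b = \<epsilon> b * (G \<bullet> b)"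
    proof cases
      case 1
      have "T (z + t *\<^sub>R b) = T z + (\<epsilon> b * t) *\<^sub>R b" for t
        unfolding T_def \<epsilon>_def 1 prod_eq_iff vec_eq_iff
        by (cases "i = k") (auto simp: reflect_nth axis_eq_axis, auto simp: axis_def)
      moreover have "G' \<bullet> b = \<epsilon> b * (G \<bullet> b)"
        by (auto simp: G'_def \<epsilon>_def 1 inner_Pair_0 inner_axis reflect_nth axis_eq_axis)
      ultimately show ?thesis by blast
    next
      case 2
      then show ?thesis
        by (simp add: T_def G'_def \<epsilon>_def prod_eq_iff inner_prod_def)
    qed
    have "deriv2 (\<lambda>t. \<epsilon> b * t) 0 (\<epsilon> b) 0"
      using deriv2_quadratic[of 0 "\<epsilon> b" 0] by simp
    from deriv2_compose[OF this, of "\<lambda>t. f (T z + t *\<^sub>R b)" "G \<bullet> b" "H b"] H(1)[OF b]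
    show "deriv2 (\<lambda>t. f (T (z + t *\<^sub>R b))) 0 (G' \<bullet> b) (H b)"
      using * by (simp add: \<epsilon>_def mult.commute split: if_splits)
  qed
  then show ?thesis
    unfolding T_def by (rule cs_opI) (simp add: v G'_def)
qed

section \<open>A growing supersolution in the quarter space\<close>

lemma conormal_mult:
  assumes "conormal \<alpha> f x \<nu>" "conormal \<alpha> g x \<nu>'"
    and "((\<lambda>y. f (x, y)) \<longlongrightarrow> f (x, 0)) (at_right 0)" "((\<lambda>y. g (x, y)) \<longlongrightarrow> g (x, 0)) (at_right 0)"
  shows "conormal \<alpha> (\<lambda>z. f z * g z) x (\<nu> * g (x, 0) + \<nu>' * f (x, 0))"
proof -
  from assms obtain D D' where
    D: "\<forall>\<^sub>F y in at_right 0. ((\<lambda>t. f (x, t)) has_real_derivative D y) (at y)"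
      "((\<lambda>y. - (y powr (1 - \<alpha>) * D y)) \<longlongrightarrow> \<nu>) (at_right 0)"
      "\<forall>\<^sub>F y in at_right 0. ((\<lambda>t. g (x, t)) has_real_derivative D' y) (at y)"
      "((\<lambda>y. - (y powr (1 - \<alpha>) * D' y)) \<longlongrightarrow> \<nu>') (at_right 0)"
    unfolding conormal_def by blast
  have "\<forall>\<^sub>F y in at_right 0. ((\<lambda>t. f (x, t) * g (x, t)) has_real_derivative
      D y * g (x, y) + D' y * f (x, y)) (at y)"
    using D(1,3) by eventually_elim (rule DERIV_mult)
  moreover have "((\<lambda>y. (- (y powr (1 - \<alpha>) * D y)) * g (x, y) + (- (y powr (1 - \<alpha>) * D' y)) * f (x, y))
      \<longlongrightarrow> \<nu> * g (x, 0) + \<nu>' * f (x, 0)) (at_right 0)"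
    by (intro tendsto_intros D assms)
  then have "((\<lambda>y. - (y powr (1 - \<alpha>) * (D y * g (x, y) + D' y * f (x, y))))
      \<longlongrightarrow> \<nu> * g (x, 0) + \<nu>' * f (x, 0)) (at_right 0)"
    by (simp add: algebra_simps)
  ultimately show ?thesis unfolding conormal_def
    by (intro exI[of _ "\<lambda>y. D y * g (x, y) + D' y * f (x, y)"] conjI)
qed

text \<open>
  A smooth function of \<open>y\<^sup>2\<close> has \<open>y\<close>-derivative of order \<open>y\<close>, hence no flux, because \<open>\<alpha> < 2\<close>.
\<close>

lemma conormal_powr_of_square:
  assumes "\<alpha> < 2" "g x > 0"
  shows "conormal \<alpha> (\<lambda>z. (g (fst z) + (snd z)\<^sup>2) powr r) x 0"
proof (rule conormalI[where D = "\<lambda>y. r * (g x + y\<^sup>2) powr (r - 1) * (2 * y)"])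
  fix y :: real assume "0 < y"
  have pos: "g x + y\<^sup>2 > 0" using assms by (simp add: add_pos_nonneg)
  have "((\<lambda>t. g x + t\<^sup>2) has_real_derivative 2 * y) (at y)"
    by (auto intro!: derivative_eq_intros)
  from DERIV_chain2[where f = "\<lambda>t. t powr r" and g = "\<lambda>t. g x + t\<^sup>2", OF has_real_derivative_powr[OF pos] this]
  show "((\<lambda>t. (g (fst (x, t)) + (snd (x, t))\<^sup>2) powr r) has_real_derivative
         r * (g x + y\<^sup>2) powr (r - 1) * (2 * y)) (at y)" by simp
next
  have "((\<lambda>y. - 2 * r * (g x + y\<^sup>2) powr (r - 1) * y powr (2 - \<alpha>)) \<longlongrightarrow>
      - 2 * r * (g x + 0\<^sup>2) powr (r - 1) * 0) (at_right 0)"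
    using assms by (intro tendsto_intros powr_at_right_0) auto
  moreover have "\<forall>\<^sub>F y in at_right 0. - 2 * r * (g x + y\<^sup>2) powr (r - 1) * y powr (2 - \<alpha>) =
      - (y powr (1 - \<alpha>) * (r * (g x + y\<^sup>2) powr (r - 1) * (2 * y)))"
    using eventually_at_right_less[of "0::real"]
  proof eventually_elim
    case (elim y)
    then show ?case using powr_mult_base[of y "1 - \<alpha>"] by (simp add: mult_ac)
  qed
  ultimately show "((\<lambda>y. - (y powr (1 - \<alpha>) * (r * (g x + y\<^sup>2) powr (r - 1) * (2 * y)))) \<longlongrightarrow> 0) (at_right 0)"
    using Lim_transform_eventually by fastforce
qed

text \<open>
  In the two variables \<open>\<sigma> = m + d - x\<^sub>k\<close> and \<open>y\<close>, and up to a constant, this is the Poisson kernel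
  \<open>y powr \<alpha> / \<bar>(\<sigma>, y)\<bar> powr (1 + \<alpha>)\<close> of the extension problem over the line, with its pole at
  distance \<open>d\<close> beyond the plane \<open>x\<^sub>k = m\<close>. It is annihilated by the operator, vanishes on \<open>y = 0\<close> and
  has negative flux there. The factor \<open>d\<close> makes it invariant under scaling and
  keeps it between \<open>0\<close> and \<open>1\<close>.
\<close>

definition edge_kernel :: "real \<Rightarrow> real \<Rightarrow> real \<Rightarrow> 'n \<Rightarrow> (real^'n) \<times> real \<Rightarrow> real" where
  "edge_kernel \<alpha> d m k z =
     d * (snd z powr \<alpha> * ((m + d - fst z $ k)\<^sup>2 + (snd z)\<^sup>2) powr (- ((1 + \<alpha>) / 2)))"

text \<open>
  The first summand is \<open>R powr (1 / 2)\<close>, where \<open>R\<close> is the distance to the point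
  \<open>x = (m + d) e\<^sub>k\<close>, \<open>y = 0\<close>. It grows in all directions, but the operator maps it to a multiple of
  \<open>R powr (- 3 / 2)\<close> that may be positive. The concave function \<open>\<sigma> powr (1 / 2)\<close> compensates for that
  in the half-space: it contributes a negative multiple of \<open>\<sigma> powr (- 3 / 2)\<close>, and
  \<open>\<sigma> \<le> R\<close>.
\<close>

definition growth :: "real \<Rightarrow> real \<Rightarrow> 'n \<Rightarrow> (real^'n) \<times> real \<Rightarrow> real" where
  "growth d m k z =
     ((norm (fst z - axis k (m + d)))\<^sup>2 + (snd z)\<^sup>2) powr (1 / 4) +
     (2 * real CARD('n) + 5) * (m + d - fst z $ k) powr (1 / 2)"

text \<open>
  The product combines growth at infinity with a positive flux, which on \<open>y = 0\<close> is proportional to the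
  barrier itself. The constant \<open>6 n + 18\<close> is chosen so that the cross term
  \<open>2 * \<nabla> edge_kernel \<bullet> \<nabla> growth\<close> is dominated by the negative contribution of \<open>growth\<close>, uniformly in
  \<open>d\<close>.
\<close>

definition barrier :: "real \<Rightarrow> real \<Rightarrow> real \<Rightarrow> 'n \<Rightarrow> (real^'n) \<times> real \<Rightarrow> real" where
  "barrier \<alpha> d m k z = (6 * real CARD('n) + 18 - edge_kernel \<alpha> d m k z) * growth d m k z"

text \<open>
  The gradient is kept explicit because the product rule for the barrier needs its inner product with
  the gradient of \<open>growth\<close>.
\<close>

lemma edge_kernel_jet:
  fixes z :: "(real^'n) \<times> real" and k :: 'n and d m :: real
  assumes y: "snd z > 0"
  defines "S \<equiv> (m + d - fst z $ k)\<^sup>2 + (snd z)\<^sup>2"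
  shows "\<exists>l. jet2 (edge_kernel \<alpha> d m k) z
      (edge_kernel \<alpha> d m k z *\<^sub>R ((\<alpha> / snd z) *\<^sub>R (0, 1) -
        ((1 + \<alpha>) / S) *\<^sub>R ((m + d - fst z $ k) *\<^sub>R (- axis k 1, 0) + snd z *\<^sub>R (0, 1)))) l \<and>
      l + (1 - \<alpha>) / snd z * snd (edge_kernel \<alpha> d m k z *\<^sub>R ((\<alpha> / snd z) *\<^sub>R (0, 1) -
        ((1 + \<alpha>) / S) *\<^sub>R ((m + d - fst z $ k) *\<^sub>R (- axis k 1 :: real^'n, 0) + snd z *\<^sub>R (0, 1)))) = 0"
proof -
  define \<sigma> where "\<sigma> = m + d - fst z $ k"
  define y where "y = snd z"
  define \<gamma> where "\<gamma> = (1 + \<alpha>) / 2"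
  define Y where "Y = y powr \<alpha>"
  define B where "B = S powr (- \<gamma>)"
  have y0: "y > 0" using y by (simp add: y_def)
  have S: "S = \<sigma>\<^sup>2 + y\<^sup>2" by (simp add: S_def \<sigma>_def y_def)
  have S0: "S > 0" using y0 by (simp add: S add_nonneg_pos)
  have q: "edge_kernel \<alpha> d m k z = d * (Y * B)"
    by (simp add: edge_kernel_def Y_def B_def S_def y_def \<gamma>_def)
  have jY: "jet2 (\<lambda>z :: (real^'n) \<times> real. snd z powr \<alpha>) z ((\<alpha> * Y / y) *\<^sub>R (0, 1)) (\<alpha> * (\<alpha> - 1) * Y / y\<^sup>2)"
    using jet2_compose[OF jet2_snd deriv2_powr[OF y, of \<alpha>]]
    by (simp add: Y_def y_def inner_prod_def)
  have jS: "jet2 (\<lambda>z. (m + d - fst z $ k)\<^sup>2 + (snd z)\<^sup>2) z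
      ((2 * \<sigma>) *\<^sub>R (- axis k 1, 0) + (2 * y) *\<^sub>R (0, 1)) 4"
    using jet2_add[OF jet2_square[OF jet2_fst_component[of "m + d" k z]] jet2_square[OF jet2_snd[of z]]]
    by (simp add: \<sigma>_def y_def inner_prod_def inner_axis_axis inner_real_def)
  have GG: "((2 * \<sigma>) *\<^sub>R (- axis k 1 :: real^'n, 0) + (2 * y) *\<^sub>R (0, 1)) \<bullet>
      ((2 * \<sigma>) *\<^sub>R (- axis k 1, 0) + (2 * y) *\<^sub>R (0, 1 :: real)) = 4 * S"
    by (simp add: inner_prod_def inner_axis_axis inner_real_def S power2_eq_square)
  have jB: "jet2 (\<lambda>z. ((m + d - fst z $ k)\<^sup>2 + (snd z)\<^sup>2) powr (- \<gamma>)) z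
     ((- \<gamma> * B / S) *\<^sub>R ((2 * \<sigma>) *\<^sub>R (- axis k 1, 0) + (2 * y) *\<^sub>R (0, 1))) (4 * \<gamma>\<^sup>2 * B / S)"
  proof (rule jet2_eq[OF jet2_compose[OF jS]])
    show "deriv2 (\<lambda>s. s powr (- \<gamma>)) ((m + d - fst z $ k)\<^sup>2 + (snd z)\<^sup>2)
        (- \<gamma> * B / S) (- \<gamma> * (- \<gamma> - 1) * B / S\<^sup>2)"
      using deriv2_powr[OF S0, of "- \<gamma>"] unfolding B_def S_def .
    show "- \<gamma> * (- \<gamma> - 1) * B / S\<^sup>2 * (((2 * \<sigma>) *\<^sub>R (- axis k 1 :: real^'n, 0) + (2 * y) *\<^sub>R (0, 1 :: real)) \<bullet>
        ((2 * \<sigma>) *\<^sub>R (- axis k 1, 0) + (2 * y) *\<^sub>R (0, 1))) + - \<gamma> * B / S * 4 = 4 * \<gamma>\<^sup>2 * B / S"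
      unfolding GG using S0 by (simp add: field_simps power2_eq_square)
  qed simp
  define l where "l = d * (\<alpha> * (\<alpha> - 1) * Y / y\<^sup>2 * B
     + 2 * ((\<alpha> * Y / y) * ((- \<gamma> * B / S) * (2 * y))) + 4 * \<gamma>\<^sup>2 * B / S * Y)"
  have j: "jet2 (edge_kernel \<alpha> d m k) z (d *\<^sub>R
      (B *\<^sub>R (\<alpha> * Y / y) *\<^sub>R (0, 1) +
       Y *\<^sub>R (- \<gamma> * B / S) *\<^sub>R ((2 * \<sigma>) *\<^sub>R (- axis k 1, 0) + (2 * y) *\<^sub>R (0, 1)))) l"
    unfolding edge_kernel_def[abs_def] \<gamma>_def[symmetric]
  proof (rule jet2_eq[OF jet2_cmult[OF jet2_mult[OF jY jB]]])
    have "((\<alpha> * Y / y) *\<^sub>R (0, 1)) \<bullet>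
        ((- \<gamma> * B / S) *\<^sub>R ((2 * \<sigma>) *\<^sub>R (- axis k 1 :: real^'n, 0) + (2 * y) *\<^sub>R (0, 1 :: real)))
      = (\<alpha> * Y / y) * ((- \<gamma> * B / S) * (2 * y))"
      by (simp add: inner_prod_def)
    then show "d * (\<alpha> * (\<alpha> - 1) * Y / y\<^sup>2 * ((m + d - fst z $ k)\<^sup>2 + (snd z)\<^sup>2) powr - \<gamma> +
        2 * (((\<alpha> * Y / y) *\<^sub>R (0, 1)) \<bullet>
        ((- \<gamma> * B / S) *\<^sub>R ((2 * \<sigma>) *\<^sub>R (- axis k 1 :: real^'n, 0) + (2 * y) *\<^sub>R (0, 1 :: real)))) +
        4 * \<gamma>\<^sup>2 * B / S * snd z powr \<alpha>) = l"
      by (simp only: l_def B_def Y_def S_def y_def)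
  qed (simp only: B_def Y_def S_def y_def)
  have G: "d *\<^sub>R (B *\<^sub>R (\<alpha> * Y / y) *\<^sub>R (0, 1) +
       Y *\<^sub>R (- \<gamma> * B / S) *\<^sub>R ((2 * \<sigma>) *\<^sub>R (- axis k 1, 0) + (2 * y) *\<^sub>R (0, 1)))
     = edge_kernel \<alpha> d m k z *\<^sub>R ((\<alpha> / y) *\<^sub>R (0, 1) -
        ((1 + \<alpha>) / S) *\<^sub>R (\<sigma> *\<^sub>R (- axis k 1 :: real^'n, 0) + y *\<^sub>R (0, 1 :: real)))"
    unfolding q prod_eq_iff using S0 by (simp add: \<gamma>_def field_simps)
  have "l + (1 - \<alpha>) / y * (d * (Y * B) * (\<alpha> / y - (1 + \<alpha>) / S * y)) = 0"
    unfolding l_def \<gamma>_def using y0 S0 by (simp add: field_simps power2_eq_square)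
  then have "l + (1 - \<alpha>) / y * snd (edge_kernel \<alpha> d m k z *\<^sub>R ((\<alpha> / y) *\<^sub>R (0, 1) -
        ((1 + \<alpha>) / S) *\<^sub>R (\<sigma> *\<^sub>R (- axis k 1 :: real^'n, 0) + y *\<^sub>R (0, 1 :: real)))) = 0"
    by (simp add: q)
  with j show ?thesis unfolding G \<sigma>_def[symmetric] y_def[symmetric] by blast
qed

text \<open>
  Both \<open>d\<close> and \<open>y\<close> are at most \<open>\<bar>(\<sigma>, y)\<bar>\<close>, and the kernel is \<open>d * y powr \<alpha>\<close> divided by
  \<open>\<bar>(\<sigma>, y)\<bar> powr (1 + \<alpha>)\<close>.
\<close>

lemma edge_kernel_bounds:
  assumes "0 < \<alpha>" "0 < d" "fst z $ k \<le> m" "0 \<le> snd z"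
  shows "0 \<le> edge_kernel \<alpha> d m k z" "edge_kernel \<alpha> d m k z \<le> 1"
proof -
  define \<sigma> where "\<sigma> = m + d - fst z $ k"
  define y where "y = snd z"
  define S where "S = \<sigma>\<^sup>2 + y\<^sup>2"
  have s: "d \<le> \<sigma>" "0 < \<sigma>" "0 \<le> y" using assms by (auto simp: \<sigma>_def y_def)
  have S0: "S > 0" using s by (simp add: S_def add_pos_nonneg)
  show "0 \<le> edge_kernel \<alpha> d m k z" using assms by (simp add: edge_kernel_def)
  have "edge_kernel \<alpha> d m k z = d * y powr \<alpha> * S powr (- ((1 + \<alpha>) / 2))"
    by (simp add: edge_kernel_def \<sigma>_def y_def S_def)
  also have "\<dots> \<le> sqrt S * sqrt S powr \<alpha> * S powr (- ((1 + \<alpha>) / 2))"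
  proof (intro mult_right_mono mult_mono powr_mono2)
    have "d\<^sup>2 \<le> S" using s assms power_mono[of d \<sigma> 2] by (simp add: S_def add_increasing2)
    then show "d \<le> sqrt S" by (rule real_le_rsqrt)
    show "y \<le> sqrt S" by (rule real_le_rsqrt) (simp add: S_def)
  qed (use assms s S0 in auto)
  also have "\<dots> = S powr (1 / 2 + \<alpha> / 2 - (1 + \<alpha>) / 2)"
    using S0 by (simp add: powr_half_sqrt[symmetric] powr_powr powr_add[symmetric] diff_conv_add_uminus
       del: add_uminus_conv_diff)
  also have "\<dots> = 1" using S0 by (simp add: add_divide_distrib)
  finally show "edge_kernel \<alpha> d m k z \<le> 1" .
qed

lemma norm_offset_ge: "\<bar>m - x $ k\<bar> \<le> norm (x - axis k m)"
  using component_le_norm_cart[of "x - axis k m" k] by (simp add: axis_def abs_minus_commute)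

lemma power2_powr: "0 < (\<sigma>::real) \<Longrightarrow> (\<sigma>\<^sup>2) powr r = \<sigma> powr (2 * r)"
  by (simp add: powr_powr flip: powr_numeral)

lemma powr_neg_three_halves:
  assumes "0 < \<sigma>" "\<sigma>\<^sup>2 \<le> (R::real)"
  shows "R powr (1 / 4) / R \<le> \<sigma> powr (1 / 2) / \<sigma>\<^sup>2"
proof -
  have R: "0 < R" using assms by (smt (verit) zero_less_power)
  have "R powr (1 / 4) / R = R powr (- (3 / 4))"
    using R powr_diff[of R "1/4" 1] by simp
  also have "\<dots> \<le> (\<sigma>\<^sup>2) powr (- (3 / 4))"
    using assms by (intro powr_mono2') auto
  also have "\<dots> = \<sigma> powr (- (3 / 2))"
    using power2_powr[OF assms(1), of "- (3 / 4)"] by simp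
  also have "\<dots> = \<sigma> powr (1 / 2) / \<sigma>\<^sup>2"
    using assms powr_diff[of \<sigma> "1/2" 2] by simp
  finally show ?thesis .
qed

text \<open>
  With \<open>T = \<sigma> powr (- 3 / 2)\<close>, \<open>n\<close> the dimension and \<open>C = 2 n + 5\<close>, the operator sends \<open>growth\<close> to at most
  \<open>- T\<close>, and the cross term is at most \<open>(1 + 3 C) T\<close>. As \<open>6 n + 18 = 3 C + 3\<close> and the kernel is at
  most \<open>1\<close>, the product is a strict supersolution.
\<close>

lemma barrier_op:
  fixes z :: "(real^'n) \<times> real" and k :: 'n
  assumes \<alpha>: "0 < \<alpha>" "\<alpha> < 2" and d: "0 < d" and xk: "fst z $ k \<le> m" and z: "0 < snd z"
  shows "\<exists>v<0. cs_op \<alpha> (barrier \<alpha> d m k) z v"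
proof -
  define n where "n = real CARD('n)"
  define \<sigma> where "\<sigma> = m + d - fst z $ k"
  define y where "y = snd z"
  define S where "S = \<sigma>\<^sup>2 + y\<^sup>2"
  define R where "R = (norm (fst z - axis k (m + d)))\<^sup>2 + y\<^sup>2"
  define P where "P = R powr (1 / 4) / R"
  define T where "T = \<sigma> powr (1 / 2) / \<sigma>\<^sup>2"
  define C where "C = 2 * n + 5"
  define q where "q = edge_kernel \<alpha> d m k z"
  define v :: "(real^'n) \<times> real" where "v = (fst z - axis k (m + d), 0)"
  have n: "n \<ge> 1" by (simp add: n_def Suc_leI)
  have s: "0 < \<sigma>" "0 < y" using xk z d by (auto simp: \<sigma>_def y_def)
  have q01: "0 \<le> q" "q \<le> 1" unfolding q_def using edge_kernel_bounds[OF \<alpha>(1) d xk] z by auto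
  have "\<sigma>\<^sup>2 \<le> (norm (fst z - axis k (m + d)))\<^sup>2"
    using norm_offset_ge[of "m + d" "fst z" k] s(1) by (intro power_mono) (auto simp: \<sigma>_def)
  then have R: "\<sigma>\<^sup>2 \<le> R" "\<sigma>\<^sup>2 \<le> S" by (simp_all add: R_def S_def add_increasing2)
  have pos: "0 < R" "0 < S" using R s(1) by (smt (verit) zero_less_power)+
  have PT: "0 \<le> P" "P \<le> T" "0 < T"
    unfolding P_def T_def using powr_neg_three_halves[OF s(1) R(1)] s pos by auto
  from edge_kernel_jet[OF z, of \<alpha> d m k] obtain l where
    jq: "jet2 (edge_kernel \<alpha> d m k) z (q *\<^sub>R ((\<alpha> / y) *\<^sub>R (0, 1) -
        ((1 + \<alpha>) / S) *\<^sub>R (\<sigma> *\<^sub>R (- axis k 1, 0) + y *\<^sub>R (0, 1)))) l" and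
    l: "l + (1 - \<alpha>) / y * (q * (\<alpha> / y - (1 + \<alpha>) / S * y)) = 0"
    unfolding q_def \<sigma>_def y_def S_def by auto
  have jR: "jet2 (\<lambda>z. (norm (fst z - axis k (m + d)))\<^sup>2 + (snd z)\<^sup>2) z
      (2 *\<^sub>R v + (2 * y) *\<^sub>R (0, 1)) (2 * n + 2)"
    using jet2_add[OF jet2_norm_fst[of "axis k (m + d)" z] jet2_square[OF jet2_snd[of z]]]
    by (simp add: v_def y_def n_def inner_prod_def)
  have GG: "(2 *\<^sub>R v + (2 * y) *\<^sub>R (0, 1)) \<bullet> (2 *\<^sub>R v + (2 * y) *\<^sub>R (0, 1)) = 4 * R"
    by (simp add: v_def R_def inner_prod_def dot_square_norm inner_real_def power2_eq_square[of y])
  have jP: "jet2 (\<lambda>z. ((norm (fst z - axis k (m + d)))\<^sup>2 + (snd z)\<^sup>2) powr (1 / 4)) z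
      ((P / 4) *\<^sub>R (2 *\<^sub>R v + (2 * y) *\<^sub>R (0, 1))) (P * (n / 2 - 1 / 4))"
  proof (rule jet2_eq[OF jet2_compose[OF jR]])
    show "deriv2 (\<lambda>s. s powr (1 / 4)) ((norm (fst z - axis k (m + d)))\<^sup>2 + (snd z)\<^sup>2)
        (P / 4) (1 / 4 * (1 / 4 - 1) * R powr (1 / 4) / R\<^sup>2)"
      using deriv2_powr[OF pos(1), of "1 / 4"] unfolding P_def R_def y_def
      by (simp add: mult.commute)
    show "1 / 4 * (1 / 4 - 1) * R powr (1 / 4) / R\<^sup>2 * ((2 *\<^sub>R v + (2 * y) *\<^sub>R (0, 1)) \<bullet>
        (2 *\<^sub>R v + (2 * y) *\<^sub>R (0, 1))) + P / 4 * (2 * n + 2) = P * (n / 2 - 1 / 4)"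
      unfolding GG P_def using pos(1) by (simp add: field_simps power2_eq_square)
  qed simp
  have jT: "jet2 (\<lambda>z. (m + d - fst z $ k) powr (1 / 2)) z
      ((\<sigma> * T / 2) *\<^sub>R (- axis k 1, 0)) (- T / 4)"
  proof (rule jet2_eq[OF jet2_compose[OF jet2_fst_component]])
    show "deriv2 (\<lambda>s. s powr (1 / 2)) (m + d - fst z $ k)
        (\<sigma> * T / 2) (1 / 2 * (1 / 2 - 1) * \<sigma> powr (1 / 2) / \<sigma>\<^sup>2)"
      using deriv2_powr[OF s(1), of "1 / 2"] s(1) unfolding T_def \<sigma>_def
      by (simp add: power2_eq_square mult.commute)
  qed (simp_all add: T_def inner_prod_def inner_axis_axis inner_real_def)
  define G\<psi> where "G\<psi> = (P / 4) *\<^sub>R (2 *\<^sub>R v + (2 * y) *\<^sub>R (0, 1)) + C *\<^sub>R ((\<sigma> * T / 2) *\<^sub>R (- axis k 1 :: real^'n, 0 :: real))"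
  define l\<psi> where "l\<psi> = P * (n / 2 - 1 / 4) + C * (- T / 4)"
  have j\<psi>: "jet2 (growth d m k) z G\<psi> l\<psi>"
    using jet2_add[OF jP jet2_cmult[OF jT, of C]]
    by (simp add: growth_def[abs_def] C_def n_def G\<psi>_def l\<psi>_def)
  define \<psi> where "\<psi> = growth d m k z"
  define Gq where "Gq = q *\<^sub>R ((\<alpha> / y) *\<^sub>R (0, 1) -
        ((1 + \<alpha>) / S) *\<^sub>R (\<sigma> *\<^sub>R (- axis k 1 :: real^'n, 0) + y *\<^sub>R (0, 1 :: real)))"
  have jK: "jet2 (\<lambda>z. 6 * n + 18 - edge_kernel \<alpha> d m k z) z (- Gq) (- l)"
    using jet2_add[OF jet2_const[of "6 * n + 18"] jet2_cmult[OF jq, of "-1"]]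
    by (simp add: Gq_def)
  have jb: "jet2 (barrier \<alpha> d m k) z (\<psi> *\<^sub>R (- Gq) + (6 * n + 18 - q) *\<^sub>R G\<psi>)
      (- l * \<psi> + 2 * ((- Gq) \<bullet> G\<psi>) + l\<psi> * (6 * n + 18 - q))"
    using jet2_mult[OF jK j\<psi>] by (simp add: barrier_def[abs_def] n_def q_def \<psi>_def)
  define e1 :: "(real^'n) \<times> real" where "e1 = (- axis k 1, 0)"
  define e2 :: "(real^'n) \<times> real" where "e2 = (0, 1)"
  have vs: "v \<bullet> e1 = \<sigma>" "v \<bullet> e2 = 0" "e1 \<bullet> v = \<sigma>" "e2 \<bullet> v = 0"
      "e1 \<bullet> e1 = 1" "e2 \<bullet> e2 = 1" "e1 \<bullet> e2 = 0" "e2 \<bullet> e1 = 0"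
    by (simp_all add: v_def e1_def e2_def inner_prod_def inner_axis inner_axis' inner_axis_axis \<sigma>_def)
  have "Gq \<bullet> G\<psi> = q * (\<alpha> / y * (P / 2 * y) - (1 + \<alpha>) / S * (\<sigma> * (P / 2 * \<sigma> + C * (\<sigma> * T / 2)) + y * (P / 2 * y)))"
    unfolding Gq_def G\<psi>_def e1_def[symmetric] e2_def[symmetric]
    by (simp add: inner_add_left inner_add_right inner_diff_left inner_diff_right vs)
       (use s pos in \<open>simp add: field_simps\<close>)
  also have "\<dots> = q * (\<alpha> * P / 2 - (1 + \<alpha>) / S * (P / 2 * S + C * (\<sigma>\<^sup>2 * T / 2)))"
    using s(2) by (simp add: S_def algebra_simps power2_eq_square)
  also have "\<dots> = - (q * (P / 2 + (1 + \<alpha>) * C * T / 2 * (\<sigma>\<^sup>2 / S)))"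
    using pos(2) by (simp add: field_simps)
  finally have cross: "Gq \<bullet> G\<psi> = - (q * (P / 2 + (1 + \<alpha>) * C * T / 2 * (\<sigma>\<^sup>2 / S)))" .
  have "(1 + \<alpha>) * C * T / 2 * (\<sigma>\<^sup>2 / S) \<le> 3 * C * T / 2 * 1"
    using \<alpha> PT R(2) pos(2) n by (intro mult_mono divide_right_mono) (auto simp: C_def)
  then have "q * (P / 2 + (1 + \<alpha>) * C * T / 2 * (\<sigma>\<^sup>2 / S)) \<le> 1 * (T / 2 + 3 * C * T / 2)"
    using q01 PT \<alpha> pos n by (intro mult_mono add_mono) (auto simp: C_def)
  with cross have c1: "- 2 * (Gq \<bullet> G\<psi>) \<le> T + 3 * C * T" by simp
  have snd\<psi>: "snd G\<psi> = P * y / 2" by (simp add: G\<psi>_def v_def)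
  have "P * (n / 2 + 1 / 4 - \<alpha> / 2) \<le> T * (n / 2 + 1 / 4)"
    using PT \<alpha> n by (smt (verit) mult_left_mono mult_right_mono divide_nonneg_nonneg)
  then have c2: "l\<psi> + (1 - \<alpha>) / y * snd G\<psi> \<le> - T"
  proof -
    have "l\<psi> + (1 - \<alpha>) / y * snd G\<psi> = P * (n / 2 + 1 / 4 - \<alpha> / 2) - (n / 2 + 5 / 4) * T"
      using s(2) unfolding snd\<psi> l\<psi>_def C_def by (simp add: field_simps)
    with \<open>P * (n / 2 + 1 / 4 - \<alpha> / 2) \<le> T * (n / 2 + 1 / 4)\<close> show ?thesis
      by (simp add: algebra_simps)
  qed
  have c3: "l + (1 - \<alpha>) / y * snd Gq = 0" using l by (simp add: Gq_def)
  define V where "V = (- l * \<psi> + 2 * ((- Gq) \<bullet> G\<psi>) + l\<psi> * (6 * n + 18 - q)) +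
      (1 - \<alpha>) / y * snd (\<psi> *\<^sub>R (- Gq) + (6 * n + 18 - q) *\<^sub>R G\<psi>)"
  have "V = (6 * n + 18 - q) * (l\<psi> + (1 - \<alpha>) / y * snd G\<psi>) - 2 * (Gq \<bullet> G\<psi>)
      - \<psi> * (l + (1 - \<alpha>) / y * snd Gq)"
    unfolding V_def by (simp add: algebra_simps)
  also have "\<dots> = (6 * n + 18 - q) * (l\<psi> + (1 - \<alpha>) / y * snd G\<psi>) - 2 * (Gq \<bullet> G\<psi>)"
    unfolding c3 by simp
  also have "\<dots> \<le> (6 * n + 18 - q) * (- T) + (T + 3 * C * T)"
    using c1 mult_left_mono[OF c2, of "6 * n + 18 - q"] q01 n by simp
  also have "\<dots> = - T * (2 - q)" by (simp add: C_def algebra_simps)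
  also have "\<dots> < 0" using PT q01 by (simp add: mult_less_0_iff)
  finally have "V < 0" .
  moreover have "cs_op \<alpha> (barrier \<alpha> d m k) z V"
    by (rule cs_opI[OF jb]) (simp add: V_def y_def)
  ultimately show ?thesis by blast
qed

lemma continuous_on_edge_kernel:
  fixes k :: "'n::finite"
  assumes "0 < \<alpha>" "0 < d"
  shows "continuous_on {z. fst z $ k \<le> m \<and> 0 \<le> snd z} (edge_kernel \<alpha> d m k)"
proof -
  have "(m + d - fst z $ k)\<^sup>2 + (snd z)\<^sup>2 \<noteq> 0" if "fst z $ k \<le> m" for z :: "(real^'n) \<times> real"
    using that assms by (auto simp: sum_power2_eq_zero_iff)
  then show ?thesis
    unfolding edge_kernel_def using assms
    by (intro continuous_intros continuous_on_powr') auto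
qed

lemma continuous_on_growth:
  fixes k :: "'n::finite"
  assumes "0 < d"
  shows "continuous_on {z. fst z $ k \<le> m \<and> 0 \<le> snd z} (growth d m k)"
  unfolding growth_def using assms by (intro continuous_intros continuous_on_powr') auto

lemma continuous_on_barrier:
  fixes k :: "'n::finite"
  assumes "0 < \<alpha>" "0 < d"
  shows "continuous_on {z. fst z $ k \<le> m \<and> 0 \<le> snd z} (barrier \<alpha> d m k)"
  unfolding barrier_def
  by (intro continuous_intros continuous_on_edge_kernel continuous_on_growth assms)

lemma tendsto_at_right_height:
  fixes f :: "(real^'n) \<times> real \<Rightarrow> real"
  assumes "continuous_on A f" "\<And>y. y \<ge> 0 \<Longrightarrow> (x, y) \<in> A"
  shows "((\<lambda>y. f (x, y)) \<longlongrightarrow> f (x, 0)) (at_right 0)"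
proof -
  have "continuous_on {0..} (\<lambda>y. f (x, y))"
    using assms(2) by (intro continuous_on_compose2[OF assms(1)] continuous_intros) auto
  then have "((\<lambda>y. f (x, y)) \<longlongrightarrow> f (x, 0)) (at 0 within {0..})"
    by (auto simp: continuous_on_def)
  then show ?thesis by (rule tendsto_within_subset) auto
qed

text \<open>
  Only the kernel contributes to the flux. For \<open>m - x\<^sub>k \<le> d\<close> the factor in front of the barrier is of
  order \<open>d powr (- \<alpha>)\<close>: narrow strips admit large potentials.
\<close>

lemma barrier_conormal:
  fixes x :: "real^'n"
  assumes \<alpha>: "0 < \<alpha>" "\<alpha> < 2" and d: "0 < d" and xk: "x $ k \<le> m"
  shows "conormal \<alpha> (barrier \<alpha> d m k) x
     (\<alpha> * d * (m + d - x $ k) powr (- (1 + \<alpha>)) / (6 * real CARD('n) + 18) * barrier \<alpha> d m k (x, 0))"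
proof -
  define K where "K = 6 * real CARD('n) + 18"
  define \<sigma> where "\<sigma> = m + d - x $ k"
  define a where "a = \<alpha> * d * \<sigma> powr (- (1 + \<alpha>))"
  have s: "\<sigma> > 0" using d xk by (simp add: \<sigma>_def)
  have R0: "norm (x - axis k (m + d)) > 0"
    using norm_offset_ge[of "m + d" x k] s unfolding \<sigma>_def by linarith
  have cB: "conormal \<alpha> (\<lambda>z. ((m + d - fst z $ k)\<^sup>2 + (snd z)\<^sup>2) powr (- ((1 + \<alpha>) / 2))) x 0"
    using s by (intro conormal_powr_of_square[where g = "\<lambda>x. (m + d - x $ k)\<^sup>2"] \<alpha>) (simp add: \<sigma>_def)
  have tB: "((\<lambda>y. (\<sigma>\<^sup>2 + y\<^sup>2) powr (- ((1 + \<alpha>) / 2))) \<longlongrightarrow> (\<sigma>\<^sup>2 + 0\<^sup>2) powr (- ((1 + \<alpha>) / 2))) (at_right 0)"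
    using s by (intro tendsto_intros) auto
  have sB: "(\<sigma>\<^sup>2) powr (- ((1 + \<alpha>) / 2)) = \<sigma> powr (- (1 + \<alpha>))"
    unfolding power2_powr[OF s] by (rule arg_cong[where f = "(powr) \<sigma>"]) (simp add: field_simps)
  have "conormal \<alpha> (\<lambda>z. snd z powr \<alpha> * ((m + d - fst z $ k)\<^sup>2 + (snd z)\<^sup>2) powr (- ((1 + \<alpha>) / 2))) x
      (- \<alpha> * \<sigma> powr (- (1 + \<alpha>)))"
    using conormal_mult[OF conormal_height_powr[of \<alpha> x] cB] powr_at_right_0[OF \<alpha>(1)] tB
    by (simp add: \<sigma>_def[symmetric] sB)
  from conormal_cmult[OF this, of d]
  have cq: "conormal \<alpha> (edge_kernel \<alpha> d m k) x (- a)"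
    by (simp add: edge_kernel_def[abs_def] a_def mult_ac)
  have cK: "conormal \<alpha> (\<lambda>z. K - edge_kernel \<alpha> d m k z) x a"
    using conormal_add[OF conormal_fst[of \<alpha> "\<lambda>_. K" x] conormal_cmult[OF cq, of "-1"]] by simp
  have c\<psi>: "conormal \<alpha> (growth d m k) x 0"
    using conormal_add[OF conormal_powr_of_square[where g = "\<lambda>x. (norm (x - axis k (m + d)))\<^sup>2" and r = "1/4"]
      conormal_fst[of \<alpha> "\<lambda>x. (2 * real CARD('n) + 5) * (m + d - x $ k) powr (1 / 2)" x]] \<alpha>(2) R0
    by (simp add: growth_def[abs_def])
  have mem: "(x, y) \<in> {z. fst z $ k \<le> m \<and> 0 \<le> snd z}" if "y \<ge> 0" for y
    using that xk by simp
  have "conormal \<alpha> (barrier \<alpha> d m k) x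
      (a * growth d m k (x, 0) + 0 * (K - edge_kernel \<alpha> d m k (x, 0)))"
    unfolding barrier_def[abs_def] K_def[symmetric]
    by (intro conormal_mult cK c\<psi> tendsto_diff tendsto_const
        tendsto_at_right_height[OF continuous_on_edge_kernel[OF \<alpha>(1) d] mem]
        tendsto_at_right_height[OF continuous_on_growth[OF d] mem])
  moreover have "barrier \<alpha> d m k (x, 0) = K * growth d m k (x, 0)" "K > 0"
    using \<alpha> by (auto simp: barrier_def K_def edge_kernel_def)
  ultimately show ?thesis by (simp add: a_def \<sigma>_def K_def[symmetric] mult.assoc)
qed

lemma barrier_ge:
  fixes z :: "(real^'n) \<times> real"
  assumes "0 < \<alpha>" "0 < d" "fst z $ k \<le> m" "0 \<le> snd z"
  shows "sqrt (norm (z - (axis k (m + d), 0))) \<le> barrier \<alpha> d m k z"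
proof -
  have eq: "(norm (fst z - axis k (m + d)))\<^sup>2 + (snd z)\<^sup>2 = (norm (z - (axis k (m + d), 0)))\<^sup>2"
    by (simp add: norm_prod_def)
  have "sqrt (norm (z - (axis k (m + d), 0))) = ((norm (z - (axis k (m + d), 0)))\<^sup>2) powr (1/4)"
    by (cases "z - (axis k (m + d), 0) = 0") (simp_all add: powr_powr powr_half_sqrt flip: powr_numeral)
  also have "\<dots> \<le> growth d m k z" using assms by (simp add: growth_def eq)
  finally have "sqrt (norm (z - (axis k (m + d), 0))) \<le> growth d m k z" .
  moreover have "1 * growth d m k z \<le> barrier \<alpha> d m k z"
    unfolding barrier_def using edge_kernel_bounds(2)[OF assms] assms
    by (intro mult_right_mono) (auto simp: growth_def)
  ultimately show ?thesis by simp
qed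

lemma barrier_pos:
  assumes "0 < \<alpha>" "0 < d" "fst z $ k \<le> m" "0 \<le> snd z"
  shows "0 < barrier \<alpha> d m k z"
proof -
  have "0 < norm (fst z - axis k (m + d))"
    using norm_offset_ge[of "m + d" "fst z" k] assms by linarith
  then have "z \<noteq> (axis k (m + d), 0)" by auto
  then show ?thesis using barrier_ge[OF assms] by (smt (verit) real_sqrt_gt_zero zero_less_norm_iff right_minus_eq)
qed

section \<open>Comparison principles\<close>

text \<open>
  A minimum of \<open>W\<close> could be lost at infinity, but \<open>W / barrier\<close> tends to \<open>0\<close> there, so a negative
  infimum \<open>\<mu>\<close> of the quotient is attained. Then \<open>W - \<mu> * barrier\<close> has minimum \<open>0\<close> and is
  a strict supersolution at the minimum point.
\<close>

lemma half_space_maximum_principle: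
  fixes W :: "(real^'n) \<times> real \<Rightarrow> real"
  assumes \<alpha>: "0 < \<alpha>" "\<alpha> < 2" and d: "0 < d"
    and cont: "continuous_on {z. 0 \<le> snd z} W"
    and bdd: "\<And>z. 0 \<le> snd z \<Longrightarrow> \<bar>W z\<bar> \<le> B"
    and zero: "\<And>z. fst z $ k = m \<Longrightarrow> 0 \<le> snd z \<Longrightarrow> W z = 0"
    and int: "\<And>z. 0 < snd z \<Longrightarrow> cs_op \<alpha> W z 0"
    and bd: "\<And>x. x $ k < m \<Longrightarrow> W (x, 0) < 0 \<Longrightarrow>
       \<exists>\<nu>. conormal \<alpha> W x \<nu> \<and>
         \<nu> > \<alpha> * d * (m + d - x $ k) powr (- (1 + \<alpha>)) / (6 * real CARD('n) + 18) * W (x, 0)"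
    and z: "fst z $ k \<le> m" "0 \<le> snd z"
  shows "0 \<le> W z"
proof (rule ccontr)
  assume "\<not> 0 \<le> W z"
  define A where "A = {z :: (real^'n) \<times> real. fst z $ k \<le> m \<and> 0 \<le> snd z}"
  define \<phi> where "\<phi> = barrier \<alpha> d m k"
  define c where "c = (axis k (m + d) :: real^'n, 0 :: real)"
  have pos: "\<phi> z > 0" if "z \<in> A" for z
    using barrier_pos[OF \<alpha>(1) d, of z k m] that by (simp add: A_def \<phi>_def)
  have "z \<in> A" using z by (simp add: A_def)
  define r where "r = W z / \<phi> z"
  have r: "r < 0" using pos[OF \<open>z \<in> A\<close>] \<open>\<not> 0 \<le> W z\<close> by (simp add: r_def divide_neg_pos)
  have B: "0 \<le> B" using bdd[OF z(2)] by simp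
  \<comment> \<open>The barrier is at least the square root of the distance to \<open>c\<close>, so outside this radius the
     quotient cannot reach \<open>r\<close>.\<close>
  define \<rho> where "\<rho> = (B / - r)\<^sup>2"
  have far: "W z' / \<phi> z' > r" if "z' \<in> A" "norm (z' - c) > \<rho>" for z'
  proof -
    have "B / - r = sqrt \<rho>" using B r by (simp add: \<rho>_def)
    also have "\<dots> < sqrt (norm (z' - c))" using that by simp
    also have "\<dots> \<le> \<phi> z'"
      using barrier_ge[OF \<alpha>(1) d, of z' k m] that by (simp add: A_def \<phi>_def c_def)
    finally have "B < - r * \<phi> z'" using r by (simp only: pos_divide_less_eq[of "- r"] neg_0_less_iff_less mult.commute)
    moreover have "- B \<le> W z'" using bdd[of z'] that by (simp add: A_def)
    ultimately have "r * \<phi> z' < W z'" by simp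
    then show ?thesis using pos[OF that(1)] by (simp add: less_divide_eq)
  qed
  define K where "K = A \<inter> cball c \<rho>"
  have "closed A"
    unfolding A_def by (intro closed_Collect_conj closed_Collect_le continuous_intros)
  then have "compact K" unfolding K_def by (simp add: closed_Int_compact)
  moreover have "z \<in> K"
    using far[OF \<open>z \<in> A\<close>] \<open>z \<in> A\<close> by (force simp: K_def r_def dist_norm norm_minus_commute)
  moreover have "continuous_on K (\<lambda>z. W z / \<phi> z)"
  proof (rule continuous_on_divide)
    show "continuous_on K W" by (rule continuous_on_subset[OF cont]) (auto simp: K_def A_def)
    show "continuous_on K \<phi>" unfolding \<phi>_def
      by (rule continuous_on_subset[OF continuous_on_barrier[OF \<alpha>(1) d, of k m]]) (auto simp: K_def A_def)
    show "\<forall>x\<in>K. \<phi> x \<noteq> 0" using pos by (force simp: K_def)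
  qed
  ultimately obtain z0 where z0: "z0 \<in> K" "\<And>z'. z' \<in> K \<Longrightarrow> W z0 / \<phi> z0 \<le> W z' / \<phi> z'"
    using continuous_attains_inf[of K "\<lambda>z. W z / \<phi> z"] by blast
  define \<mu> where "\<mu> = W z0 / \<phi> z0"
  have \<mu>: "\<mu> \<le> r" using z0(2)[OF \<open>z \<in> K\<close>] by (simp add: \<mu>_def r_def)
  then have \<mu>0: "\<mu> < 0" using r by simp
  have "z0 \<in> A" using z0(1) by (simp add: K_def)
  have min: "\<mu> \<le> W z' / \<phi> z'" if "z' \<in> A" for z'
    using that z0(2)[of z'] far[OF that] \<mu> by (cases "z' \<in> K") (auto simp: K_def \<mu>_def dist_norm norm_minus_commute)
  define F where "F = (\<lambda>z. W z + (- \<mu>) * \<phi> z)"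
  have F0: "F z0 = 0" using pos[OF \<open>z0 \<in> A\<close>] by (simp add: F_def \<mu>_def)
  have W0: "W z0 = \<mu> * \<phi> z0" "W z0 < 0"
    using pos[OF \<open>z0 \<in> A\<close>] \<mu>0 F0 by (auto simp: F_def mult_neg_pos)
  have z0k: "fst z0 $ k < m" "0 \<le> snd z0"
    using zero[of z0] W0 \<open>z0 \<in> A\<close> by (force simp: A_def)+
  have Fpos: "F z0 \<le> F z'" if "z' \<in> A" for z'
    using min[OF that] pos[OF that] unfolding F0 by (simp add: F_def le_divide_eq)
  show False
  proof (rule min_principle[where U = "{z. fst z $ k < m}" and z = z0 and A = A and F = F and \<alpha> = \<alpha>])
    show "open {z :: (real^'n) \<times> real. fst z $ k < m}"
      by (intro open_Collect_less continuous_intros)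
    show "z0 \<in> {z. fst z $ k < m}" using z0k by simp
    show "continuous_on A F" unfolding F_def \<phi>_def
      by (intro continuous_intros continuous_on_subset[OF cont]
          continuous_on_subset[OF continuous_on_barrier[OF \<alpha>(1) d, of k m]]) (auto simp: A_def)
    show "\<exists>v<0. cs_op \<alpha> F z0 v" if y: "0 < snd z0"
    proof -
      obtain v where v: "v < 0" "cs_op \<alpha> \<phi> z0 v"
        using barrier_op[OF \<alpha> d less_imp_le[OF z0k(1)] y] unfolding \<phi>_def by blast
      have "cs_op \<alpha> F z0 (0 + (- \<mu>) * v)" unfolding F_def
        by (intro cs_op_add int y cs_op_cmult v)
      moreover have "0 + (- \<mu>) * v < 0" using \<mu>0 v(1) by (simp add: mult_neg_neg)
      ultimately show ?thesis by blast
    qed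
    show "\<exists>\<nu>>0. conormal \<alpha> F (fst z0) \<nu>" if y: "snd z0 = 0"
    proof -
      have z0eq: "z0 = (fst z0, 0)" using y by (simp add: prod_eq_iff)
      define a where "a = \<alpha> * d * (m + d - fst z0 $ k) powr (- (1 + \<alpha>)) / (6 * real CARD('n) + 18)"
      have "conormal \<alpha> \<phi> (fst z0) (a * \<phi> (fst z0, 0))"
        unfolding a_def \<phi>_def by (rule barrier_conormal[OF \<alpha> d less_imp_le[OF z0k(1)]])
      then have c\<phi>: "conormal \<alpha> \<phi> (fst z0) (a * \<phi> z0)" using z0eq by metis
      obtain \<nu> where \<nu>: "conormal \<alpha> W (fst z0) \<nu>" "\<nu> > a * W z0"
        using bd[OF z0k(1)] W0(2) z0eq unfolding a_def by metis
      have "conormal \<alpha> F (fst z0) (\<nu> + (- \<mu>) * (a * \<phi> z0))" unfolding F_def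
        by (intro conormal_add conormal_cmult \<nu> c\<phi>)
      moreover have "\<nu> + (- \<mu>) * (a * \<phi> z0) > 0" using \<nu>(2) W0(1) by (simp add: algebra_simps)
      ultimately show ?thesis by blast
    qed
  qed (use z0k Fpos in \<open>auto simp: A_def\<close>)
qed

lemma compact_comparison:
  fixes F :: "(real^'n) \<times> real \<Rightarrow> real"
  assumes "compact S" "continuous_on S F" "open U"
    and US: "U \<inter> {z. 0 \<le> snd z} \<subseteq> S" "\<And>z. z \<in> S \<Longrightarrow> 0 \<le> snd z"
    and side: "\<And>z. z \<in> S \<Longrightarrow> z \<notin> U \<Longrightarrow> 0 \<le> F z"
    and int: "\<And>z. z \<in> U \<Longrightarrow> 0 < snd z \<Longrightarrow> \<exists>v<0. cs_op \<alpha> F z v"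
    and bd: "\<And>x. (x, 0) \<in> U \<Longrightarrow> \<exists>\<nu>>0. conormal \<alpha> F x \<nu>"
    and z: "z \<in> S"
  shows "0 \<le> F z"
proof (rule ccontr)
  assume neg: "\<not> 0 \<le> F z"
  obtain z0 where z0: "z0 \<in> S" "\<And>z'. z' \<in> S \<Longrightarrow> F z0 \<le> F z'"
    using continuous_attains_inf[OF assms(1) _ assms(2)] z by blast
  have "z0 \<in> U" using side[OF z0(1)] z0(2)[OF z] neg by linarith
  show False
  proof (rule min_principle[OF assms(3) \<open>z0 \<in> U\<close> US(2)[OF z0(1)] _ US(1) assms(2), of \<alpha>])
    show "\<And>z'. z' \<in> U \<Longrightarrow> 0 \<le> snd z' \<Longrightarrow> F z0 \<le> F z'" using z0(2) US(1) by blast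
    show "0 < snd z0 \<Longrightarrow> \<exists>v<0. cs_op \<alpha> F z0 v" by (rule int[OF \<open>z0 \<in> U\<close>])
    show "\<exists>\<nu>>0. conormal \<alpha> F (fst z0) \<nu>" if "snd z0 = 0"
      using bd[of "fst z0"] \<open>z0 \<in> U\<close> that by (metis prod.collapse)
  qed
qed

lemma conormal_reflect:
  assumes "conormal \<alpha> f (reflect m k x) \<nu>"
  shows "conormal \<alpha> (\<lambda>z. f (reflect m k (fst z), snd z)) x \<nu>"
  using assms unfolding conormal_def by simp

section \<open>Moving planes\<close>

lemma powr_diff_le:
  assumes "1 < p" "0 \<le> b" "b \<le> (a::real)"
  shows "a powr p - b powr p \<le> p * a powr (p - 1) * (a - b)"
proof (cases "a = b")
  case False
  then have ab: "b < a" using assms by simp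
  have "\<exists>l z. b < z \<and> z < a \<and> ((\<lambda>t. t powr p) has_real_derivative l) (at z) \<and>
      a powr p - b powr p = (a - b) * l"
  proof (rule MVT[OF ab])
    show "continuous_on {b..a} (\<lambda>t. t powr p)"
      using assms by (intro continuous_on_powr' continuous_intros) auto
    show "(\<lambda>t. t powr p) differentiable at t" if "b < t" for t
      using has_real_derivative_powr[of t p] that assms unfolding real_differentiable_def by auto
  qed
  then obtain l z where z: "b < z" "z < a" "((\<lambda>t. t powr p) has_real_derivative l) (at z)"
    "a powr p - b powr p = (a - b) * l" by blast
  have "l = p * z powr (p - 1)"
    using z assms by (intro DERIV_unique[OF z(3)] has_real_derivative_powr) auto
  moreover have "z powr (p - 1) \<le> a powr (p - 1)"
    using z assms by (intro powr_mono2) auto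
  ultimately have "(a - b) * l \<le> (a - b) * (p * a powr (p - 1))"
    using ab assms by (intro mult_left_mono) auto
  then show ?thesis by (simp add: z(4) mult_ac)
qed simp

text \<open>
  The nonlinear equation for \<open>u\<close> enters as a flux condition for \<open>w\<close> on \<open>y = 0\<close>.
\<close>

locale cs_solution =
  fixes \<alpha> p M :: real and u :: "real^'n \<Rightarrow> real" and w :: "(real^'n) \<times> real \<Rightarrow> real" and k :: 'n
  assumes \<alpha>: "0 < \<alpha>" "\<alpha> < 2" and p: "1 < p"
    and ext: "cs_extension \<alpha> u w"
    and nonneg: "\<And>x. 0 \<le> u x"
    and bound: "\<And>z. 0 \<le> snd z \<Longrightarrow> \<bar>w z\<bar> \<le> M"
    and flux: "\<And>x. conormal \<alpha> w x (cs_const \<alpha> * (x $ k * u x powr p))"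
begin

abbreviation c where "c \<equiv> cs_const \<alpha>"

definition W :: "real \<Rightarrow> (real^'n) \<times> real \<Rightarrow> real" where
  "W m z = w (reflect m k (fst z), snd z) - w z"

lemma c_pos: "0 < c"
  unfolding cs_const_def using \<alpha> by (intro divide_pos_pos mult_pos_pos Gamma_real_pos) auto

lemma trace: "w (x, 0) = u x"
  using ext by (simp add: cs_extension_def)

lemma continuous_w: "continuous_on {z. 0 \<le> snd z} w"
  using ext by (simp add: cs_extension_def)

lemma u_le: "u x \<le> M"
  using bound[of "(x, 0)"] by (simp add: trace)

lemma M_nonneg: "0 \<le> M"
  using u_le nonneg order_trans by blast

lemma W_trace: "W m (x, 0) = u (reflect m k x) - u x"
  by (simp add: W_def trace)

lemma continuous_W: "continuous_on {z. 0 \<le> snd z} (W m)"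
  unfolding W_def reflect_def
  by (intro continuous_intros continuous_on_compose2[OF continuous_w]) auto

lemma abs_W_le: "0 \<le> snd z \<Longrightarrow> \<bar>W m z\<bar> \<le> 2 * M"
  using bound[of z] bound[of "(reflect m k (fst z), snd z)"] by (simp add: W_def)

lemma W_plane: "fst z $ k = m \<Longrightarrow> W m z = 0"
  by (simp add: W_def reflect_def)

lemma W_op:
  assumes "0 < snd z"
  shows "cs_op \<alpha> (W m) z 0"
proof -
  have "cs_op \<alpha> (\<lambda>z. w (reflect m k (fst z), snd z) + (-1) * w z) z (0 + (-1) * 0)"
    using assms by (intro cs_op_add cs_op_cmult cs_op_reflect cs_extension_op[OF ext]) auto
  then show ?thesis by (simp add: W_def[abs_def])
qed

lemma W_flux:
  "conormal \<alpha> (W m) x (c * ((2 * m - x $ k) * u (reflect m k x) powr p - x $ k * u x powr p))"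
proof -
  have "conormal \<alpha> (\<lambda>z. w (reflect m k (fst z), snd z) + (-1) * w z) x
      (c * (reflect m k x $ k * u (reflect m k x) powr p) + (-1) * (c * (x $ k * u x powr p)))"
    by (intro conormal_add conormal_cmult conormal_reflect flux)
  then show ?thesis by (simp add: W_def[abs_def] reflect_nth algebra_simps)
qed

text \<open>
  On a half-ball of radius \<open>1\<close> centred on the plane \<open>x\<^sub>k = m\<close>, times the interval
  \<open>0 \<le> y \<le> h\<close>, the flux of \<open>W m\<close> is
  bounded by some \<open>K\<close>. The multiple \<open>- K / \<alpha>\<close> of \<open>y powr \<alpha>\<close> absorbs it at the price of an additive
  constant proportional to \<open>h powr \<alpha>\<close>, which is small with \<open>h\<close>. The quadratic terms dominate
  \<open>\<bar>W m\<bar> \<le> 2 M\<close> on the curved side and on the top, and \<open>2 s - s\<^sup>2\<close>, with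
  \<open>s = m - x\<^sub>k\<close>, makes the sum a supersolution; it vanishes on the plane. On the
  normal to the plane through the centre, at \<open>y = 0\<close>, what remains is \<open>\<omega> / 2 + O(s)\<close>.
\<close>

lemma W_lower_modulus:
  assumes \<Lambda>: "0 \<le> \<Lambda>" and \<omega>: "0 < \<omega>"
  shows "\<exists>\<delta>>0. \<forall>m x. \<bar>m\<bar> \<le> \<Lambda> \<longrightarrow> 0 \<le> m - x $ k \<longrightarrow> m - x $ k \<le> \<delta> \<longrightarrow> - \<omega> \<le> W m (x, 0)"
proof -
  define n where "n = real CARD('n)"
  define K where "K = c * (2 * (\<Lambda> + 1)) * M powr p + 1"
  have K: "0 < K" using c_pos \<Lambda> by (simp add: K_def add_nonneg_pos)
  \<comment> \<open>This height makes \<open>K / \<alpha> * h powr \<alpha>\<close> equal to \<open>\<omega> / 2\<close>.\<close>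
  define h where "h = (\<alpha> * \<omega> / (2 * K)) powr (1 / \<alpha>)"
  have h: "0 < h" using \<alpha> \<omega> K by (simp add: h_def)
  have "h powr \<alpha> = \<alpha> * \<omega> / (2 * K)" using \<alpha> \<omega> K by (simp add: h_def powr_powr)
  then have hK: "K / \<alpha> * h powr \<alpha> = \<omega> / 2" using \<alpha> K by simp
  \<comment> \<open>The operator maps the quadratic terms to \<open>4 * M * (n + (2 - \<alpha>) / h\<^sup>2)\<close> and \<open>2 s - s\<^sup>2\<close> to
     \<open>- 2\<close>.\<close>
  define A where "A = 2 * M * (n + (2 - \<alpha>) / h\<^sup>2) + 1"
  have A: "0 < A" using M_nonneg \<alpha> by (simp add: A_def n_def add_nonneg_pos)
  define \<delta> where "\<delta> = min 1 (\<omega> / 2 / (2 * M + 2 * A))"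
  have \<delta>: "0 < \<delta>" using \<omega> A M_nonneg by (simp add: \<delta>_def add_nonneg_pos)
  have "- \<omega> \<le> W m (x, 0)" if m: "\<bar>m\<bar> \<le> \<Lambda>" and s: "0 \<le> m - x $ k" "m - x $ k \<le> \<delta>" for m x
  proof -
    define x0 where "x0 = x + (m - x $ k) *\<^sub>R axis k 1"
    have x0k: "x0 $ k = m" by (simp add: x0_def)
    define B :: "(real^'n) \<times> real \<Rightarrow> real" where "B = (\<lambda>z. (\<omega> / 2 + (- K / \<alpha>) * snd z powr \<alpha>) +
        ((2 * M) * ((norm (fst z - x0))\<^sup>2 + (1 / h\<^sup>2) * (snd z)\<^sup>2) +
         A * (2 * (m - fst z $ k) + (-1) * (m - fst z $ k)\<^sup>2)))"
    define F where "F = (\<lambda>z. W m z + B z)"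
    define S :: "((real^'n) \<times> real) set" where "S = cball x0 1 \<times> {0..h} \<inter> {z. fst z $ k \<le> m}"
    define U :: "((real^'n) \<times> real) set" where "U = ball x0 1 \<times> {..<h} \<inter> {z. fst z $ k < m}"
    have s01: "m - x' $ k \<le> norm (x' - x0)" for x'
      using component_le_norm_cart[of "x' - x0" k] by (simp add: x0k)
    have Bside: "0 \<le> \<omega> / 2 + (- K / \<alpha>) * y powr \<alpha>" if "0 \<le> y" "y \<le> h" for y
    proof -
      have "K / \<alpha> * y powr \<alpha> \<le> K / \<alpha> * h powr \<alpha>"
        using that K \<alpha> by (intro mult_left_mono powr_mono2) auto
      then show ?thesis unfolding hK by simp
    qed
    have Aside: "0 \<le> A * (2 * (m - x' $ k) + (-1) * (m - x' $ k)\<^sup>2)" if "x' $ k \<le> m" "norm (x' - x0) \<le> 1" for x'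
    proof -
      have "(m - x' $ k)\<^sup>2 \<le> 1 * (m - x' $ k)"
        using that s01[of x'] unfolding power2_eq_square by (intro mult_right_mono) auto
      then show ?thesis using A that by simp
    qed
    have "0 \<le> F (x, 0)"
    proof (rule compact_comparison[of S F U \<alpha>])
      show "compact S" unfolding S_def
        by (intro compact_Int_closed compact_Times closed_Collect_le continuous_intros) auto
      have "continuous_on {z. 0 \<le> snd z} F"
        unfolding F_def B_def using \<alpha> by (intro continuous_intros continuous_W continuous_on_powr') auto
      then show "continuous_on S F" by (rule continuous_on_subset) (auto simp: S_def)
      show "open U" unfolding U_def
        by (intro open_Int open_Times open_Collect_less continuous_intros) auto
      show "U \<inter> {z. 0 \<le> snd z} \<subseteq> S" by (auto simp: U_def S_def)
      show "\<And>z. z \<in> S \<Longrightarrow> 0 \<le> snd z" by (auto simp: S_def)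
      show "(x, 0) \<in> S"
        using s h by (auto simp: S_def x0_def dist_norm \<delta>_def)
      show "0 \<le> F z" if zS: "z \<in> S" and zU: "z \<notin> U" for z
      proof -
        have z: "norm (fst z - x0) \<le> 1" "0 \<le> snd z" "snd z \<le> h" "fst z $ k \<le> m"
          using zS by (auto simp: S_def dist_norm norm_minus_commute)
        have B2: "2 * M * ((norm (fst z - x0))\<^sup>2 + (1 / h\<^sup>2) * (snd z)\<^sup>2) \<le> B z"
          using Bside[OF z(2,3)] Aside[OF z(4,1)] unfolding B_def by linarith
        consider "norm (fst z - x0) = 1" | "snd z = h" | "fst z $ k = m"
          using zU z by (force simp: U_def dist_norm norm_minus_commute mem_Times_iff)
        then show ?thesis
        proof cases
          case 1
          have "2 * M * 1 \<le> 2 * M * ((norm (fst z - x0))\<^sup>2 + (1 / h\<^sup>2) * (snd z)\<^sup>2)"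
            using M_nonneg 1 by (intro mult_left_mono) auto
          then show ?thesis using B2 abs_W_le[OF z(2), of m] by (simp add: F_def)
        next
          case 2
          have "2 * M * 1 \<le> 2 * M * ((norm (fst z - x0))\<^sup>2 + (1 / h\<^sup>2) * (snd z)\<^sup>2)"
            using M_nonneg 2 h by (intro mult_left_mono) auto
          then show ?thesis using B2 abs_W_le[OF z(2), of m] by (simp add: F_def)
        next
          case 3
          have "0 \<le> 2 * M * ((norm (fst z - x0))\<^sup>2 + (1 / h\<^sup>2) * (snd z)\<^sup>2)"
            using M_nonneg by simp
          then show ?thesis using B2 W_plane[OF 3] by (simp add: F_def)
        qed
      qed
      show "\<exists>v<0. cs_op \<alpha> F z v" if "0 < snd z" for z
      proof -
        have "cs_op \<alpha> F z (0 + ((0 + (- K / \<alpha>) * 0) + ((2 * M) * (2 * real CARD('n) + (1 / h\<^sup>2) * (2 * (2 - \<alpha>))) +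
            A * (2 * 0 + (-1) * 2))))"
          unfolding F_def B_def
          by (intro cs_op_add cs_op_cmult W_op cs_op_const cs_op_height_powr cs_op_norm_fst
              cs_op_height_square cs_op_fst_component cs_op_fst_component_square that)
        moreover have "0 + ((0 + (- K / \<alpha>) * 0) + ((2 * M) * (2 * real CARD('n) + (1 / h\<^sup>2) * (2 * (2 - \<alpha>))) +
            A * (2 * 0 + (-1) * 2))) = - 2"
          by (simp add: A_def n_def field_simps)
        ultimately show ?thesis by (intro exI[of _ "- 2"]) auto
      qed
      show "\<exists>\<nu>>0. conormal \<alpha> F x' \<nu>" if "(x', 0) \<in> U" for x'
      proof -
        define \<nu> where "\<nu> = c * ((2 * m - x' $ k) * u (reflect m k x') powr p - x' $ k * u x' powr p)"
        have x': "norm (x' - x0) < 1" "x' $ k < m"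
          using that by (auto simp: U_def dist_norm norm_minus_commute)
        have up: "u y powr p \<le> M powr p" for y using u_le nonneg p by (intro powr_mono2) auto
        have "\<bar>x' $ k\<bar> \<le> \<Lambda> + 1" "\<bar>2 * m - x' $ k\<bar> \<le> \<Lambda> + 1"
          using m x' s01[of x'] by auto
        then have "\<bar>(2 * m - x' $ k) * u (reflect m k x') powr p\<bar> \<le> (\<Lambda> + 1) * M powr p"
            "\<bar>x' $ k * u x' powr p\<bar> \<le> (\<Lambda> + 1) * M powr p"
          unfolding abs_mult using up \<Lambda> by (auto intro!: mult_mono)
        then have "- (2 * (\<Lambda> + 1) * M powr p) \<le> (2 * m - x' $ k) * u (reflect m k x') powr p - x' $ k * u x' powr p"
          by linarith
        from mult_left_mono[OF this, of c] c_pos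
        have "- K < \<nu>" by (simp add: \<nu>_def K_def algebra_simps)
        have "conormal \<alpha> F x' (\<nu> + ((0 + (- K / \<alpha>) * (- \<alpha>)) + ((2 * M) * (0 + (1 / h\<^sup>2) * 0) + 0)))"
          unfolding F_def B_def \<nu>_def
          by (intro conormal_add conormal_cmult W_flux conormal_height_powr conormal_height_square \<alpha>
             conormal_fst[where f = "\<lambda>x. \<omega> / 2"] conormal_fst[where f = "\<lambda>x. (norm (x - x0))\<^sup>2"]
             conormal_fst[where f = "\<lambda>x. A * (2 * (m - x $ k) + (-1) * (m - x $ k)\<^sup>2)"])
        then have "conormal \<alpha> F x' (\<nu> + K)" using \<alpha> by simp
        with \<open>- K < \<nu>\<close> show ?thesis by (intro exI[of _ "\<nu> + K"]) auto
      qed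
    qed
    moreover have "B (x, 0) \<le> \<omega>"
    proof -
      define \<sigma> where "\<sigma> = m - x $ k"
      have \<sigma>: "0 \<le> \<sigma>" "\<sigma> \<le> 1" "\<sigma> \<le> \<omega> / 2 / (2 * M + 2 * A)" using s by (auto simp: \<sigma>_def \<delta>_def)
      have "B (x, 0) = \<omega> / 2 + (2 * M * \<sigma>\<^sup>2 + A * (2 * \<sigma> - \<sigma>\<^sup>2))"
        using \<alpha> s by (simp add: B_def x0_def \<sigma>_def)
      also have "\<dots> \<le> \<omega> / 2 + (2 * M * \<sigma> + A * (2 * \<sigma>))"
        using M_nonneg A \<sigma> power_le_one[of \<sigma> 1] mult_right_mono[of \<sigma> 1 \<sigma>]
        by (intro add_mono mult_left_mono order_refl) (auto simp: power2_eq_square)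
      also have "\<dots> = \<omega> / 2 + (2 * M + 2 * A) * \<sigma>" by (simp add: algebra_simps)
      also have "\<dots> \<le> \<omega>"
      proof -
        have "0 < 2 * M + 2 * A" using M_nonneg A by simp
        from \<sigma>(3)[unfolded pos_le_divide_eq[OF this]] show ?thesis by (simp add: mult.commute)
      qed
      finally show ?thesis .
    qed
    ultimately show ?thesis by (simp add: F_def)
  qed
  with \<delta> show ?thesis by blast
qed

text \<open>
  The maximum principle is applied with the distance \<open>d\<close> of the pole so small that strips of width
  \<open>d\<close> tolerate the largest possible potential \<open>Q\<close>. On the whole strip this \<open>d\<close> leaves some positive margin,
  which determines the threshold \<open>\<eta>\<close> below which \<open>u\<close> counts as small. The tolerance \<open>\<omega>\<close> then keeps
  the reflected value at least \<open>\<eta> / 2\<close> wherever \<open>u \<ge> \<eta>\<close>, so that at distance at least \<open>d\<close> from the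
  plane the term \<open>2 s * u powr p\<close> at the reflected point gives at least \<open>E\<close> to the flux.
\<close>

lemma W_nonneg_of_almost:
  assumes \<Lambda>: "0 < \<Lambda>"
  shows "\<exists>\<omega>>0. \<forall>m. 0 \<le> m \<longrightarrow> m \<le> \<Lambda> \<longrightarrow>
     (\<forall>x. 0 < x $ k \<longrightarrow> x $ k < m \<longrightarrow> - \<omega> \<le> W m (x, 0)) \<longrightarrow>
     (\<forall>x. x $ k \<le> m \<longrightarrow> 0 \<le> W m (x, 0))"
proof -
  define n where "n = 6 * real CARD('n) + 18"
  have n: "0 < n" by (simp add: n_def)
  define Q where "Q = c * \<Lambda> * p * M powr (p - 1)"
  have Q: "0 \<le> Q" using c_pos \<Lambda> p by (simp add: Q_def)
  define Z where "Z = Q * n * 2 powr (1 + \<alpha>) / \<alpha>"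
  have Z: "0 \<le> Z" using Q n \<alpha> by (simp add: Z_def)
  \<comment> \<open>At distance \<open>d\<close> from the plane the coefficient of the barrier is
     \<open>\<alpha> * d powr (- \<alpha>) / (n * 2 powr (1 + \<alpha>))\<close>, and it decreases with the distance.\<close>
  define d where "d = (Z + 1) powr (- (1 / \<alpha>))"
  have d: "0 < d" using Z by (simp add: d_def)
  define a where "a = (\<lambda>s. \<alpha> * d * (s + d) powr (- (1 + \<alpha>)) / n)"
  have a_pos: "0 < a s" if "0 \<le> s" for s using that d \<alpha> n by (simp add: a_def)
  have a_mono: "a t \<le> a s" if "0 \<le> s" "s \<le> t" for s t
    unfolding a_def using that d \<alpha> n
    by (intro divide_right_mono mult_left_mono powr_mono2') auto
  have "Q < a d"
  proof -
    have "d powr (- \<alpha>) = Z + 1" using Z \<alpha> by (simp add: d_def powr_powr)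
    moreover have "d * (d + d) powr (- (1 + \<alpha>)) = d powr (- \<alpha>) / 2 powr (1 + \<alpha>)"
    proof -
      have "(d + d) powr (- (1 + \<alpha>)) = 2 powr (- (1 + \<alpha>)) * d powr (- (1 + \<alpha>))"
        using d powr_mult[of 2 d "- (1 + \<alpha>)"] by simp
      moreover have "d * d powr (- (1 + \<alpha>)) = d powr (- \<alpha>)"
        using d powr_mult_base[of d "- (1 + \<alpha>)"] by (simp del: minus_add_distrib)
      moreover have "2 powr (- (1 + \<alpha>)) = 1 / 2 powr (1 + \<alpha>)"
        by (rule powr_minus_divide)
      ultimately show ?thesis by (simp only: mult.left_commute) simp
    qed
    ultimately have "a d = \<alpha> * ((Z + 1) / 2 powr (1 + \<alpha>)) / n"
      by (simp add: a_def mult.assoc)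
    also have "\<dots> = Q + \<alpha> / (2 powr (1 + \<alpha>) * n)"
      using \<alpha> n by (simp add: Z_def field_simps)
    finally show ?thesis using \<alpha> n by simp
  qed
  have cLp: "0 < c * \<Lambda> * p" using c_pos \<Lambda> p by simp
  define \<eta> where "\<eta> = (a \<Lambda> / (2 * (c * \<Lambda> * p))) powr (1 / (p - 1))"
  have \<eta>: "0 < \<eta>" using a_pos[of \<Lambda>] \<Lambda> c_pos p by (simp add: \<eta>_def)
  have "\<eta> powr (p - 1) = a \<Lambda> / (2 * (c * \<Lambda> * p))"
    using p a_pos[of \<Lambda>] \<Lambda> cLp by (simp add: \<eta>_def powr_powr)
  then have \<eta>a: "c * \<Lambda> * p * \<eta> powr (p - 1) < a \<Lambda>"
    using c_pos p a_pos[of \<Lambda>] \<Lambda> by (simp add: field_simps)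
  define E where "E = c * (2 * d * (\<eta> / 2) powr p)"
  have E: "0 < E" using c_pos d \<eta> by (simp add: E_def)
  define \<omega> where "\<omega> = min (\<eta> / 2) (E / (Q + 1))"
  have \<omega>: "0 < \<omega>" "\<omega> \<le> \<eta> / 2" unfolding \<omega>_def using \<eta> E Q by (simp, intro min.cobounded1)
  have "Q * \<omega> \<le> Q * (E / (Q + 1))" using Q by (intro mult_left_mono) (auto simp: \<omega>_def)
  also have "\<dots> < E" using Q E by (simp add: field_simps)
  finally have Q\<omega>: "Q * \<omega> < E" .
  have "0 \<le> W m (x0, 0)" if m: "0 \<le> m" "m \<le> \<Lambda>"
    and strip: "\<And>x. 0 < x $ k \<Longrightarrow> x $ k < m \<Longrightarrow> - \<omega> \<le> W m (x, 0)" and x0: "x0 $ k \<le> m" for m x0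
  proof (rule half_space_maximum_principle[OF \<alpha> d continuous_W abs_W_le W_plane W_op])
    fix x :: "real^'n" assume xk: "x $ k < m" and neg: "W m (x, 0) < 0"
    define s where "s = m - x $ k"
    define U where "U = u x"
    define V where "V = u (reflect m k x)"
    define \<nu> where "\<nu> = c * ((2 * m - x $ k) * V powr p - x $ k * U powr p)"
    have s: "0 < s" using xk by (simp add: s_def)
    have VU: "0 \<le> V" "V < U" and WUV: "W m (x, 0) = V - U"
      using nonneg neg by (auto simp: V_def U_def W_trace)
    have "a s * W m (x, 0) < \<nu>"
    proof (cases "x $ k \<le> 0")
      case True
      then have "0 \<le> (2 * m - x $ k) * V powr p" "x $ k * U powr p \<le> 0"
        using m by (auto intro!: mult_nonneg_nonneg mult_nonpos_nonneg)
      then have "0 \<le> \<nu>" unfolding \<nu>_def using c_pos by (intro mult_nonneg_nonneg) auto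
      then show ?thesis using mult_pos_neg[OF a_pos[of s] neg] s by simp
    next
      case False
      then have xk0: "0 < x $ k" "x $ k \<le> \<Lambda>" and sL: "s \<le> \<Lambda>" using xk m by (auto simp: s_def)
      have "x $ k * (U powr p - V powr p) \<le> \<Lambda> * (p * U powr (p - 1) * (U - V))"
        using powr_diff_le[OF p VU(1), of U] VU xk0 p by (intro mult_mono) (auto intro!: powr_mono2)
      then have "2 * s * V powr p - \<Lambda> * (p * U powr (p - 1) * (U - V)) \<le>
          (2 * m - x $ k) * V powr p - x $ k * U powr p"
        by (simp add: s_def algebra_simps)
      from mult_left_mono[OF this, of c] c_pos
      have \<nu>ge: "c * (2 * s * V powr p) - c * \<Lambda> * p * U powr (p - 1) * (U - V) \<le> \<nu>"
        by (simp add: \<nu>_def algebra_simps)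
      have UM: "c * \<Lambda> * p * U powr (p - 1) \<le> Q"
        unfolding Q_def U_def using cLp p u_le nonneg by (intro mult_left_mono powr_mono2) auto
      have as: "a s * W m (x, 0) = - (a s * (U - V))" by (simp add: WUV algebra_simps)
      have Vp: "0 \<le> c * (2 * s * V powr p)" using c_pos s by simp
      consider "s \<le> d" | "U < \<eta>" | "d < s" "\<eta> \<le> U" by linarith
      then show ?thesis
      proof cases
        case 1
        then have "Q < a s" using a_mono[of s d] s \<open>Q < a d\<close> by simp
        then have "c * \<Lambda> * p * U powr (p - 1) * (U - V) < a s * (U - V)"
          using UM VU by (intro mult_strict_right_mono) auto
        then show ?thesis using \<nu>ge Vp as by linarith
      next
        case 2
        have "c * \<Lambda> * p * U powr (p - 1) \<le> c * \<Lambda> * p * \<eta> powr (p - 1)"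
          using cLp p 2 VU by (intro mult_left_mono powr_mono2) auto
        also have "\<dots> < a s" using \<eta>a a_mono[of s \<Lambda>] s sL by simp
        finally have "c * \<Lambda> * p * U powr (p - 1) * (U - V) < a s * (U - V)"
          using VU by (intro mult_strict_right_mono) auto
        then show ?thesis using \<nu>ge Vp as by linarith
      next
        case 3
        have "U - V \<le> \<omega>" using strip[OF xk0(1) xk] WUV by simp
        then have "c * \<Lambda> * p * U powr (p - 1) * (U - V) \<le> Q * \<omega>"
          using UM Q VU by (intro mult_mono) auto
        moreover have "E \<le> c * (2 * s * V powr p)"
          unfolding E_def using c_pos d 3 \<open>U - V \<le> \<omega>\<close> \<omega> \<eta> p
          by (intro mult_left_mono mult_mono powr_mono2) auto
        moreover have "a s * W m (x, 0) < 0" using mult_pos_neg[OF a_pos[of s] neg] s by simp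
        ultimately show ?thesis using \<nu>ge Q\<omega> by linarith
      qed
    qed
    moreover have "a s = \<alpha> * d * (m + d - x $ k) powr (- (1 + \<alpha>)) / (6 * real CARD('n) + 18)"
      by (simp add: a_def s_def n_def algebra_simps)
    ultimately show "\<exists>\<nu>. conormal \<alpha> (W m) x \<nu> \<and>
        \<nu> > \<alpha> * d * (m + d - x $ k) powr (- (1 + \<alpha>)) / (6 * real CARD('n) + 18) * W m (x, 0)"
      using W_flux[of m x] unfolding \<nu>_def U_def V_def by auto
  qed (use x0 in auto)
  with \<omega>(1) show ?thesis by blast
qed

lemma reflect_reflect: "reflect (m' + m - x $ k) k (reflect m k x) = reflect m' k x"
  by (simp add: vec_eq_iff reflect_nth)

text \<open>
  At \<open>m = 0\<close> the strip is empty. Passing from \<open>m0\<close> to a slightly larger \<open>m'\<close>, the two reflections of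
  a point with \<open>x\<^sub>k \<le> m0\<close> are mirror images in the plane \<open>x\<^sub>k = m' + m0 - x\<^sub>k\<close>, and for the
  remaining points of the strip the plane \<open>m'\<close> itself is close; in both cases the modulus of
  continuity bounds the loss.
\<close>

lemma W_nonneg:
  assumes "0 \<le> m" "x $ k \<le> m"
  shows "0 \<le> W m (x, 0)"
proof -
  define \<Lambda> where "\<Lambda> = m + 1"
  define P where "P m = (\<forall>x. x $ k \<le> m \<longrightarrow> 0 \<le> W m (x, 0))" for m
  have \<Lambda>: "0 < \<Lambda>" "m \<le> \<Lambda>" using assms by (auto simp: \<Lambda>_def)
  from W_nonneg_of_almost[OF \<Lambda>(1)] obtain \<omega> where \<omega>: "0 < \<omega>"
    "\<And>m. 0 \<le> m \<Longrightarrow> m \<le> \<Lambda> \<Longrightarrow> (\<And>x. 0 < x $ k \<Longrightarrow> x $ k < m \<Longrightarrow> - \<omega> \<le> W m (x, 0)) \<Longrightarrow> P m"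
    unfolding P_def by blast
  from W_lower_modulus[of "2 * \<Lambda>", OF _ \<omega>(1)] \<Lambda> obtain \<delta> where \<delta>: "0 < \<delta>"
    "\<And>m x. \<bar>m\<bar> \<le> 2 * \<Lambda> \<Longrightarrow> 0 \<le> m - x $ k \<Longrightarrow> m - x $ k \<le> \<delta> \<Longrightarrow> - \<omega> \<le> W m (x, 0)"
    by auto
  have step: "P m'" if m: "P m0" "0 \<le> m0" "m0 \<le> m'" "m' \<le> m0 + \<delta>" "m' \<le> \<Lambda>" for m0 m'
  proof (rule \<omega>(2))
    fix x assume x: "0 < x $ k" "x $ k < m'"
    show "- \<omega> \<le> W m' (x, 0)"
    proof (cases "x $ k \<le> m0")
      case True
      have "- \<omega> \<le> W (m' + m0 - x $ k) (reflect m0 k x, 0)"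
        by (rule \<delta>(2)) (use m x True in \<open>auto simp: reflect_nth\<close>)
      moreover have "0 \<le> W m0 (x, 0)" using m(1) True by (simp add: P_def)
      ultimately show ?thesis by (simp add: W_trace reflect_reflect)
    next
      case False
      then show ?thesis by (intro \<delta>(2)) (use m x in auto)
    qed
  qed (use m in auto)
  have "P (min m (real i * \<delta>))" for i
  proof (induction i)
    case 0
    have "P 0" by (rule \<omega>(2)) (use \<Lambda> in auto)
    then show ?case using assms by simp
  next
    case (Suc i)
    show ?case
      by (rule step[OF Suc]) (use assms \<delta>(1) \<Lambda> in \<open>auto simp: min_def algebra_simps\<close>)
  qed
  moreover obtain i where "m < real i * \<delta>" using ex_less_of_nat_mult[OF \<delta>(1)] by auto
  ultimately have "P m" by (metis min.absorb1 less_imp_le)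
  then show ?thesis using assms by (simp add: P_def)
qed

lemma u_mono:
  assumes "0 \<le> x $ k" "0 \<le> t"
  shows "u x \<le> u (x + t *\<^sub>R axis k 1)"
proof -
  have "reflect (x $ k + t / 2) k x = x + t *\<^sub>R axis k 1"
    by (simp add: reflect_def)
  then show ?thesis using W_nonneg[of "x $ k + t / 2" x] assms by (simp add: W_trace)
qed

section \<open>Vanishing of the solution\<close>

text \<open>
  If the flux exceeds \<open>q * \<alpha>\<close> on a ball, then \<open>w\<close> lies above
  \<open>- M + q * (b - y powr \<alpha> - \<bar>x - x0\<bar>\<^sup>2 + A * y\<^sup>2)\<close>: this is a subsolution, and it is at most
  \<open>- M\<close> on the sides of a sufficiently flat cylinder. At the centre it equals \<open>q * b - M\<close>, which is more
  than \<open>M\<close> for large \<open>q\<close>.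
\<close>

lemma no_large_flux:
  assumes r: "0 < r"
  shows "\<exists>Q. \<forall>x0. \<not> (\<forall>x. norm (x - x0) \<le> r \<longrightarrow> Q \<le> c * (x $ k * u x powr p))"
proof -
  define n where "n = real CARD('n)"
  \<comment> \<open>The operator maps \<open>- \<bar>x - x0\<bar>\<^sup>2 + A * y\<^sup>2\<close> to \<open>- 2 n + 2 (2 - \<alpha>) A = 2\<close>.\<close>
  define A where "A = (n + 1) / (2 - \<alpha>)"
  have A: "0 < A" using \<alpha> by (simp add: A_def n_def)
  have "((\<lambda>h. A * h powr (2 - \<alpha>)) \<longlongrightarrow> A * 0) (at_right 0)"
    using \<alpha> by (intro tendsto_intros powr_at_right_0) auto
  then have 1: "\<forall>\<^sub>F h in at_right 0. A * h powr (2 - \<alpha>) < 1 / 2"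
    by (intro order_tendstoD) auto
  have "((\<lambda>h. A * h\<^sup>2) \<longlongrightarrow> A * 0\<^sup>2) (at_right 0)"
    by (intro tendsto_intros)
  then have 2: "\<forall>\<^sub>F h in at_right 0. A * h\<^sup>2 < r\<^sup>2 / 2"
    using r by (intro order_tendstoD) auto
  have "\<forall>\<^sub>F h in at_right 0. 0 < h \<and> A * h powr (2 - \<alpha>) < 1 / 2 \<and> A * h\<^sup>2 < r\<^sup>2 / 2"
    using 1 2 eventually_at_right_less[of "0::real"] by eventually_elim auto
  then obtain h where h: "0 < h" "A * h powr (2 - \<alpha>) < 1 / 2" "A * h\<^sup>2 < r\<^sup>2 / 2"
    using eventually_happens'[OF trivial_limit_at_right_real[of 0]] by blast
  have "A * h\<^sup>2 = A * h powr (2 - \<alpha>) * h powr \<alpha>"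
    using h(1) by (simp flip: powr_add powr_numeral)
  also have "\<dots> \<le> 1 / 2 * h powr \<alpha>" using h by (intro mult_right_mono) auto
  finally have h\<alpha>: "A * h\<^sup>2 \<le> h powr \<alpha> / 2" by simp
  define b where "b = min (h powr \<alpha> / 2) (r\<^sup>2 / 2)"
  have b: "0 < b" using h r by (simp add: b_def)
  define q where "q = (2 * M + 1) / b"
  have q: "0 < q" using M_nonneg b by (simp add: q_def)
  have "\<not> (\<forall>x. norm (x - x0) \<le> r \<longrightarrow> q * \<alpha> + 1 \<le> c * (x $ k * u x powr p))" for x0
  proof
    assume Q: "\<forall>x. norm (x - x0) \<le> r \<longrightarrow> q * \<alpha> + 1 \<le> c * (x $ k * u x powr p)"
    define F where "F = (\<lambda>z. w z + ((M - q * b) + (q * (snd z powr \<alpha>) +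
        (q * (norm (fst z - x0))\<^sup>2 + (- q * A) * (snd z)\<^sup>2))))"
    have Feq: "F z = w z + M + q * (snd z powr \<alpha> + (norm (fst z - x0))\<^sup>2 - A * (snd z)\<^sup>2 - b)" for z
      by (simp add: F_def algebra_simps)
    have "0 \<le> F (x0, 0)"
    proof (rule compact_comparison[of "cball x0 r \<times> {0..h}" F "ball x0 r \<times> {..<h}" \<alpha>])
      have "continuous_on {z. 0 \<le> snd z} F"
        unfolding F_def using \<alpha> by (intro continuous_intros continuous_w continuous_on_powr') auto
      then show "continuous_on (cball x0 r \<times> {0..h}) F"
        by (rule continuous_on_subset) auto
      show "0 \<le> F z" if zS: "z \<in> cball x0 r \<times> {0..h}" and zU: "z \<notin> ball x0 r \<times> {..<h}" for z
      proof -
        have z: "0 \<le> snd z" "snd z \<le> h" using zS by auto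
        have "0 \<le> snd z powr \<alpha> + (norm (fst z - x0))\<^sup>2 - A * (snd z)\<^sup>2 - b"
        proof -
          have y2: "A * (snd z)\<^sup>2 \<le> A * h\<^sup>2" using A z by (intro mult_left_mono power_mono) auto
          consider "norm (fst z - x0) = r" | "snd z = h"
            using zU zS by (force simp: dist_norm norm_minus_commute mem_Times_iff)
          then show ?thesis
          proof cases
            case 1
            have "0 \<le> snd z powr \<alpha>" by simp
            then show ?thesis using y2 h(3) unfolding 1 b_def by linarith
          next
            case 2
            have "0 \<le> (norm (fst z - x0))\<^sup>2" by simp
            then show ?thesis using h\<alpha> unfolding 2 b_def by linarith
          qed
        qed
        then have "0 \<le> q * (snd z powr \<alpha> + (norm (fst z - x0))\<^sup>2 - A * (snd z)\<^sup>2 - b)"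
          using q by simp
        then show ?thesis using bound[OF z(1)] unfolding Feq by linarith
      qed
      show "\<exists>v<0. cs_op \<alpha> F z v" if "0 < snd z" for z
      proof -
        have "cs_op \<alpha> F z (0 + (0 + (q * 0 + (q * (2 * real CARD('n)) + (- q * A) * (2 * (2 - \<alpha>))))))"
          unfolding F_def
          by (intro cs_op_add cs_op_cmult cs_extension_op[OF ext] cs_op_const cs_op_height_powr cs_op_norm_fst
              cs_op_height_square that)
        moreover have "0 + (0 + (q * 0 + (q * (2 * real CARD('n)) + (- q * A) * (2 * (2 - \<alpha>))))) = - 2 * q"
          using \<alpha> by (simp add: A_def n_def field_simps)
        ultimately show ?thesis using q by (intro exI[of _ "- 2 * q"]) auto
      qed
      show "\<exists>\<nu>>0. conormal \<alpha> F x \<nu>" if "(x, 0) \<in> ball x0 r \<times> {..<h}" for x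
      proof -
        have "conormal \<alpha> F x (c * (x $ k * u x powr p) + (0 + (q * (- \<alpha>) + (q * 0 + (- q * A) * 0))))"
          unfolding F_def
          by (intro conormal_add conormal_cmult flux conormal_height_powr conormal_height_square \<alpha>
             conormal_fst[where f = "\<lambda>x. M - q * b"] conormal_fst[where f = "\<lambda>x. (norm (x - x0))\<^sup>2"])
        moreover have "q * \<alpha> + 1 \<le> c * (x $ k * u x powr p)"
          using Q that by (auto simp: dist_norm norm_minus_commute)
        ultimately show ?thesis
          by (intro exI[of _ "c * (x $ k * u x powr p) + (0 + (q * (- \<alpha>) + (q * 0 + (- q * A) * 0)))"]) auto
      qed
    qed (use r h in \<open>auto intro!: compact_Times open_Times\<close>)
    then have "q * b \<le> w (x0, 0) + M" using \<alpha> by (simp add: Feq algebra_simps)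
    then show False using bound[of "(x0, 0)"] b by (simp add: q_def)
  qed
  then show ?thesis by blast
qed

lemma continuous_u: "continuous_on UNIV u"
proof -
  have "continuous_on UNIV (\<lambda>x. w (x, 0))"
    by (intro continuous_on_compose2[OF continuous_w] continuous_intros) auto
  then show ?thesis by (simp add: trace)
qed

text \<open>
  A positive value can be reflected to the side \<open>x\<^sub>k \<ge> 1\<close>. It persists on a small ball there and, by
  monotonicity, on all translates of the ball in the direction of \<open>e\<^sub>k\<close>.
\<close>

lemma u_eq_0: "u x = 0"
proof (rule ccontr)
  assume "u x \<noteq> 0"
  then have ux: "0 < u x" using nonneg[of x] by simp
  define x1 where "x1 = reflect (\<bar>x $ k\<bar> + 1) k x"
  have x1k: "1 \<le> x1 $ k" by (simp add: x1_def reflect_nth)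
  have "u x \<le> u x1"
    using W_nonneg[of "\<bar>x $ k\<bar> + 1" x] by (simp add: W_trace x1_def)
  then have u1: "0 < u x1" using ux by simp
  define a where "a = u x1 / 2"
  have a: "0 < a" "a < u x1" using u1 by (auto simp: a_def)
  have "isCont u x1" using continuous_u by (simp add: continuous_on_eq_continuous_at)
  then have "\<forall>\<^sub>F x in nhds x1. a < u x"
    unfolding isCont_def using a(2) by (intro order_tendstoD(1)[where y = "u x1"])
      (simp_all add: tendsto_at_iff_tendsto_nhds)
  then obtain e where e: "0 < e" "\<And>x. dist x x1 < e \<Longrightarrow> a < u x"
    unfolding eventually_nhds_metric by blast
  define r where "r = min (e / 2) (1 / 2)"
  have r: "0 < r" "r < e" "r \<le> 1 / 2" using e(1) by (auto simp: r_def)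
  from no_large_flux[OF r(1)] obtain Q where
    Q: "\<And>x0. \<not> (\<forall>x. norm (x - x0) \<le> r \<longrightarrow> Q \<le> c * (x $ k * u x powr p))" by blast
  define t where "t = \<bar>Q\<bar> / (c * a powr p)"
  have ca: "0 < c * a powr p" using c_pos a by simp
  then have t: "0 \<le> t" "c * (t * a powr p) = \<bar>Q\<bar>" by (auto simp: t_def)
  have "Q \<le> c * (x' $ k * u x' powr p)" if x': "norm (x' - (x1 + t *\<^sub>R axis k 1)) \<le> r" for x'
  proof -
    define x2 where "x2 = x' - t *\<^sub>R axis k 1"
    have x2: "norm (x2 - x1) \<le> r" using x' by (simp add: x2_def algebra_simps)
    have "\<bar>(x2 - x1) $ k\<bar> \<le> r" using component_le_norm_cart[of "x2 - x1" k] x2 by linarith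
    then have x2k: "0 \<le> x2 $ k" using x1k r(3) by (simp add: abs_le_iff)
    have "a \<le> u x2" using e(2)[of x2] x2 r(2) by (simp add: dist_norm)
    also have "\<dots> \<le> u x'" using u_mono[OF x2k t(1)] by (simp add: x2_def)
    finally have "a powr p \<le> u x' powr p" using a p by (intro powr_mono2) auto
    moreover have "t \<le> x' $ k" using x2k by (simp add: x2_def)
    ultimately have "c * (t * a powr p) \<le> c * (x' $ k * u x' powr p)"
      using t(1) c_pos by (intro mult_left_mono mult_mono) auto
    then show ?thesis using t(2) by linarith
  qed
  then show False using Q by blast
qed

end

theorem corollary1:
  fixes \<alpha> p :: real and u :: "real^'n \<Rightarrow> real" and k :: 'n
  assumes "1 \<le> \<alpha>" and "\<alpha> < 2" and "\<alpha> < real CARD('n)"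
    and "\<And>x. 0 \<le> u x" and "bounded (range u)"
    and "has_frac_laplacian \<alpha> u (\<lambda>x. x $ k * u x powr p)"
    and "1 < p"
  shows "\<forall>x. u x = 0"
proof -
  obtain w where w: "cs_extension \<alpha> u w"
    "\<And>x. ((\<lambda>y. - (y powr (1 - \<alpha>) * deriv (\<lambda>t. w (x, t)) y))
        \<longlongrightarrow> cs_const \<alpha> * (x $ k * u x powr p)) (at_right 0)"
    using assms(6) unfolding has_frac_laplacian_def by blast
  have "bounded (w ` {z. 0 \<le> snd z})" using w(1) by (simp add: cs_extension_def)
  then obtain M where M: "\<And>z. 0 \<le> snd z \<Longrightarrow> \<bar>w z\<bar> \<le> M"
    unfolding bounded_iff real_norm_def by blast
  interpret cs_solution \<alpha> p M u w k
  proof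
    show "conormal \<alpha> w x (cs_const \<alpha> * (x $ k * u x powr p))" for x
    proof (rule conormalI[OF _ w(2)])
      fix y :: real assume "0 < y"
      then have "w differentiable (at (x, y))"
        using w(1) unfolding cs_extension_def C2_on_def C1_on_def by auto
      then have "((\<lambda>t. w (x, t)) has_derivative (\<lambda>h. frechet_derivative w (at (x, y)) (0, h))) (at y)"
        by (intro has_derivative_compose[where f = "\<lambda>t. (x, t)" and g = w])
          (auto intro!: derivative_eq_intros simp: frechet_derivative_works[symmetric])
      then have "(\<lambda>t. w (x, t)) differentiable (at y)" by (rule differentiableI)
      then show "((\<lambda>t. w (x, t)) has_real_derivative deriv (\<lambda>t. w (x, t)) y) (at y)"
        by (simp add: DERIV_deriv_iff_real_differentiable)
    qed
  qed (use assms w(1) M in auto)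
  show ?thesis using u_eq_0 by blast
qed

end
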